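(* Let $f$ be a convex real-valued function on bipartite states. Then $f$ is LOCC monotone if and only if [LUI] for all states $\rho_{AB}$ and unitaries $U_A,U_B$: $f\big((U_A\otimes U_B)\rho_{AB}(U_A\otimes U_B)^\dagger\big)=f(\rho_{AB})$; and [FLAGS] for every finite family of states $\rho^i_{AB}$, probabilities $p_i$, and orthonormal vectors $|i\rangle_X$ of a local ancilla $X\in\{A',B'\}$: $$f\Big(\sum_i p_i\,\rho^i_{AB}\otimes|i\rangle_X\langle i|\Big)=\sum_i p_i\, f(\rho^i_{AB}).$$ The same holds for multipartite systems.
   Context: States are density operators on finite-dimensional Hilbert spaces. $f$ is defined on states of bipartite systems $\mathcal H_A\otimes\mathcal H_B$ for all finite local dimensions; a state on $AA'\otimes B$ (or $A\otimes BB'$) with an ancilla $A'$ held by Alice (or $B'$ held by Bob) is regarded as a bipartite state between Alice and Bob. $f$ is convex: $f(\sum_i p_i\rho_i)\le\sum_i p_i f(\rho_i)$. $f$ is called LOCC monotone if for every operation implementable by local operations and classical communication, which on input $\rho_{AB}$ yields outcome $i$ with probability $p_i$ and post-measurement state $\sigma^i_{AB}$, one has $f(\rho_{AB})\ge\sum_i p_i f(\sigma^i_{AB})$. *)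

theory Defs
  imports "Jordan_Normal_Form.Schur_Decomposition"
begin

definition mtrace :: "complex mat \<Rightarrow> complex" where
  "mtrace A = (\<Sum>i<dim_row A. A $$ (i, i))"

definition msum :: "nat \<Rightarrow> ('i \<Rightarrow> complex mat) \<Rightarrow> 'i set \<Rightarrow> complex mat" where
  "msum d F I = mat d d (\<lambda>ij. \<Sum>i\<in>I. F i $$ ij)"

definition kron :: "complex mat \<Rightarrow> complex mat \<Rightarrow> complex mat" where
  "kron A B = mat (dim_row A * dim_row B) (dim_col A * dim_col B)
     (\<lambda>(i, j). A $$ (i div dim_row B, j div dim_col B) * B $$ (i mod dim_row B, j mod dim_col B))"

fun kron_list :: "complex mat list \<Rightarrow> complex mat" where
  "kron_list [] = 1\<^sub>m 1"
| "kron_list (A # As) = kron A (kron_list As)"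

definition unitary_mat :: "nat \<Rightarrow> complex mat \<Rightarrow> bool" where
  "unitary_mat d U \<longleftrightarrow> U \<in> carrier_mat d d \<and> mat_adjoint U * U = 1\<^sub>m d \<and> U * mat_adjoint U = 1\<^sub>m d"

definition psd :: "nat \<Rightarrow> complex mat \<Rightarrow> bool" where
  "psd d A \<longleftrightarrow> A \<in> carrier_mat d d \<and>
     (\<forall>v \<in> carrier_vec d. Im (conjugate v \<bullet> (A *\<^sub>v v)) = 0 \<and> 0 \<le> Re (conjugate v \<bullet> (A *\<^sub>v v)))"

definition density :: "nat \<Rightarrow> complex mat \<Rightarrow> bool" where
  "density d \<rho> \<longleftrightarrow> psd d \<rho> \<and> mtrace \<rho> = 1"

text \<open>A system of N parties is described by the list ds of local dimensions
  (length ds = N); the global space is C^(ds!0) \<otimes> ... \<otimes> C^(ds!(N-1)),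
  party 0 being the most significant tensor factor. Bipartite: N = 2,
  Alice = party 0, Bob = party 1.\<close>

abbreviation tdim :: "nat list \<Rightarrow> nat" where
  "tdim ds \<equiv> prod_list ds"

definition mstate :: "nat list \<Rightarrow> complex mat \<Rightarrow> bool" where
  "mstate ds \<rho> \<longleftrightarrow> density (tdim ds) \<rho>"

definition loc :: "nat list \<Rightarrow> nat \<Rightarrow> complex mat \<Rightarrow> complex mat" where
  "loc ds k K = kron (1\<^sub>m (prod_list (take k ds))) (kron K (1\<^sub>m (prod_list (drop (Suc k) ds))))"

text \<open>An LOCC operation on a system with local dimensions ds is represented by the
  list of its outcomes. Each outcome is a pair (ds', Ls): ds' the local output
  dimensions, Ls a list of Kraus operators (tdim ds' x tdim ds matrices); on
  input \<rho> the (unnormalised) output of this outcome is the sum of L \<rho> L^dagger.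
  LOCC protocols are generated by: doing nothing; a round in which one party k
  performs a local instrument (outcomes j, each given by Kraus operators
  K : C^(ds!k) \<rightarrow> C^(d_j), jointly complete: sum K^dagger K = I), broadcasts j, and the
  parties then continue with an LOCC protocol P j depending on j (local dimensions
  may change, covering local ancillas and discarding of subsystems); and
  coarse-graining (merging) of two outcomes with the same output dimensions.\<close>

inductive locc :: "nat list \<Rightarrow> (nat list \<times> complex mat list) list \<Rightarrow> bool" where
  locc_id: "locc ds [(ds, [1\<^sub>m (tdim ds)])]"
| locc_round:
    "\<lbrakk> k < length ds;
       \<forall>j < length instr. \<forall>K \<in> set (snd (instr ! j)). K \<in> carrier_mat (fst (instr ! j)) (ds ! k);
       msum (ds ! k) (\<lambda>i. mat_adjoint (concat (map snd instr) ! i) * (concat (map snd instr) ! i))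
            {..< length (concat (map snd instr))} = 1\<^sub>m (ds ! k);
       \<forall>j < length instr. locc (ds[k := fst (instr ! j)]) (P j) \<rbrakk>
     \<Longrightarrow> locc ds (concat (map (\<lambda>j. map (\<lambda>(ds'', Ls). (ds'',
              [L * loc ds k K. L \<leftarrow> Ls, K \<leftarrow> snd (instr ! j)])) (P j)) [0..< length instr]))"
| locc_merge:
    "\<lbrakk> locc ds outs; i < length outs; j < length outs; i \<noteq> j; fst (outs ! i) = fst (outs ! j) \<rbrakk>
     \<Longrightarrow> locc ds (let outs' = outs[i := (fst (outs ! i), snd (outs ! i) @ snd (outs ! j))]
                 in take j outs' @ drop (Suc j) outs')"

definition out_unnorm :: "nat list \<times> complex mat list \<Rightarrow> complex mat \<Rightarrow> complex mat" where
  "out_unnorm o' \<rho> = msum (tdim (fst o'))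
      (\<lambda>i. (snd o' ! i) * \<rho> * mat_adjoint (snd o' ! i)) {..< length (snd o')}"

definition out_prob :: "nat list \<times> complex mat list \<Rightarrow> complex mat \<Rightarrow> real" where
  "out_prob o' \<rho> = Re (mtrace (out_unnorm o' \<rho>))"

definition out_state :: "nat list \<times> complex mat list \<Rightarrow> complex mat \<Rightarrow> complex mat" where
  "out_state o' \<rho> = complex_of_real (1 / out_prob o' \<rho>) \<cdot>\<^sub>m out_unnorm o' \<rho>"

text \<open>f ds \<rho> is the value of f on the state \<rho> of the N-partite system with local
  dimensions ds; only its values on states (with length ds = N) matter.\<close>

definition convex_fun :: "nat \<Rightarrow> (nat list \<Rightarrow> complex mat \<Rightarrow> real) \<Rightarrow> bool" where
  "convex_fun N f \<longleftrightarrow>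
    (\<forall>ds n (p :: nat \<Rightarrow> real) \<rho>. length ds = N \<longrightarrow> (\<forall>i<n. mstate ds (\<rho> i) \<and> 0 \<le> p i) \<longrightarrow>
       (\<Sum>i<n. p i) = 1 \<longrightarrow>
       f ds (msum (tdim ds) (\<lambda>i. complex_of_real (p i) \<cdot>\<^sub>m \<rho> i) {..<n}) \<le> (\<Sum>i<n. p i * f ds (\<rho> i)))"

definition locc_monotone :: "nat \<Rightarrow> (nat list \<Rightarrow> complex mat \<Rightarrow> real) \<Rightarrow> bool" where
  "locc_monotone N f \<longleftrightarrow>
    (\<forall>ds outs \<rho>. length ds = N \<longrightarrow> locc ds outs \<longrightarrow> mstate ds \<rho> \<longrightarrow>
       (\<Sum>o'\<leftarrow>outs. out_prob o' \<rho> * f (fst o') (out_state o' \<rho>)) \<le> f ds \<rho>)"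

definition LUI :: "nat \<Rightarrow> (nat list \<Rightarrow> complex mat \<Rightarrow> real) \<Rightarrow> bool" where
  "LUI N f \<longleftrightarrow>
    (\<forall>ds \<rho> Us. length ds = N \<longrightarrow> mstate ds \<rho> \<longrightarrow> length Us = N \<longrightarrow>
       (\<forall>k<N. unitary_mat (ds ! k) (Us ! k)) \<longrightarrow>
       f ds (kron_list Us * \<rho> * mat_adjoint (kron_list Us)) = f ds \<rho>)"

text \<open>[FLAGS] for orthonormal flags x_i of a local ancilla X (dimension m) held by
  party k: the state \<Sum>i p_i \<rho>_i \<otimes> |x_i><x_i|_X lives on the system where party k
  has local space C^(ds!k) \<otimes> C^m; \<rho>_i \<otimes> |x_i><x_i| = V_i \<rho>_i V_i^dagger with the local
  isometry V_i = I \<otimes> |x_i> on party k.\<close>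
definition flag_iso :: "nat list \<Rightarrow> nat \<Rightarrow> nat \<Rightarrow> complex vec \<Rightarrow> complex mat" where
  "flag_iso ds k m x = loc ds k (kron (1\<^sub>m (ds ! k)) (mat m 1 (\<lambda>(r, _). x $ r)))"

definition FLAGS :: "nat \<Rightarrow> (nat list \<Rightarrow> complex mat \<Rightarrow> real) \<Rightarrow> bool" where
  "FLAGS N f \<longleftrightarrow>
    (\<forall>ds k m n (p :: nat \<Rightarrow> real) \<rho> x. length ds = N \<longrightarrow> k < N \<longrightarrow>
       (\<forall>i<n. mstate ds (\<rho> i) \<and> 0 \<le> p i \<and> x i \<in> carrier_vec m) \<longrightarrow>
       (\<Sum>i<n. p i) = 1 \<longrightarrow>
       (\<forall>i<n. \<forall>j<n. conjugate (x i) \<bullet> x j = (if i = j then 1 else 0)) \<longrightarrow>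
       f (ds[k := ds ! k * m])
         (msum (tdim (ds[k := ds ! k * m]))
            (\<lambda>i. complex_of_real (p i) \<cdot>\<^sub>m
                 (flag_iso ds k m (x i) * \<rho> i * mat_adjoint (flag_iso ds k m (x i)))) {..<n})
       = (\<Sum>i<n. p i * f ds (\<rho> i)))"

end

theory Submission
  imports Defs
begin

text \<open>A function \<open>f\<close> on states is extended homogeneously to positive semidefinite matrices by
  \<open>A \<mapsto> tr A * f (A / tr A)\<close>; convexity becomes subadditivity, and outcome probabilities and
  post-measurement states disappear from all statements.

  For sufficiency, embed the outputs of a local instrument with Kraus operators \<open>K\<^sub>j\<close> into a common space
  and combine them with flags into the isometries \<open>W\<^sub>a = \<Sum>\<^sub>j \<omega>\<^bsup>a j\<^esup> K\<^sub>j \<otimes> |j + 1\<rangle>\<close>, where \<open>\<omega>\<close> is a primitive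
  root of unity. Each \<open>W\<^sub>a\<close> is orthogonal to the embedding with flag \<open>|0\<rangle>\<close>, so a local unitary maps the
  flagged input to the image of \<open>W\<^sub>a\<close> without changing \<open>f\<close>. Averaging over \<open>a\<close> removes the cross terms,
  convexity shows that \<open>f\<close> does not increase, and [FLAGS] evaluates the average.

  Conversely, a local unitary and its inverse are LOCC operations; for [FLAGS] one inequality is
  convexity together with local isometries, the other is the measurement of the flag.\<close>

section \<open>Matrices\<close>

text \<open>The two conditions compare few systems: [LUI] keeps every local dimension and [FLAGS]
  multiplies one of them. An LOCC outcome may end in any local dimension \<open>e i\<close>. Hence
  the outputs are brought to dimension \<open>D\<close>, a multiple of the input dimension and of
  every nonzero \<open>e i\<close>, by adjoining pure flags, which leaves \<open>f\<close>
  unchanged. Flag 0 is reserved for the input because isometries with orthogonal ranges are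
  exchanged by an explicit reflection; no orthonormal basis has to be completed. A single
  \<open>W a\<close> keeps coherences between the flags, whereas [FLAGS] evaluates only mixtures
  that are block diagonal in them. This is why n isometries differing only in phases are needed:
  each yields the value of the input, and their mixture is decohered. Every Kraus operator gets its
  own flag. Outcomes with several Kraus operators are recovered by subadditivity, since forgetting
  information is mixing. In the converse, the flags need not span the ancilla, so their measurement
  has to be completed by a further outcome, which has probability zero.\<close>

lemma mat_adjoint_dim [simp]: "dim_row (mat_adjoint A) = dim_col A" "dim_col (mat_adjoint A) = dim_row A"
  by (auto simp: mat_adjoint_def)

lemma mat_adjoint_index [simp]:
  fixes A :: "complex mat"
  assumes "i < dim_col A" "j < dim_row A"
  shows "mat_adjoint A $$ (i, j) = cnj (A $$ (j, i))"
  using assms by (simp add: mat_adjoint_def mat_of_rows_def)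

lemma mat_adjoint_carrier [simp]: "A \<in> carrier_mat r c \<Longrightarrow> mat_adjoint A \<in> carrier_mat c r"
  by (intro carrier_matI) simp_all

lemma mat_mult_index:
  fixes A :: "complex mat"
  assumes "A \<in> carrier_mat r n" "B \<in> carrier_mat n c" "i < r" "j < c"
  shows "(A * B) $$ (i, j) = (\<Sum>k<n. A $$ (i, k) * B $$ (k, j))"
  using assms by (auto simp: scalar_prod_def atLeast0LessThan intro!: sum.cong)

lemma mat_adjoint_adjoint [simp]: "mat_adjoint (mat_adjoint (A :: complex mat)) = A"
  by (rule eq_matI) auto

lemma mat_adjoint_mult:
  fixes A :: "complex mat"
  assumes A: "A \<in> carrier_mat r n" and B: "B \<in> carrier_mat n c"
  shows "mat_adjoint (A * B) = mat_adjoint B * mat_adjoint A"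
proof (rule eq_matI)
  fix i j assume "i < dim_row (mat_adjoint B * mat_adjoint A)" "j < dim_col (mat_adjoint B * mat_adjoint A)"
  then have ij: "i < c" "j < r" using A B by auto
  then show "mat_adjoint (A * B) $$ (i, j) = (mat_adjoint B * mat_adjoint A) $$ (i, j)"
    using A B by (subst mat_mult_index[of _ c n _ r])
      (auto simp: mat_mult_index[OF A B] mult.commute intro!: sum.cong simp del: index_mult_mat(1))
qed (use A B in auto)

lemma mat_adjoint_one [simp]: "mat_adjoint (1\<^sub>m n :: complex mat) = 1\<^sub>m n"
  by (rule eq_matI) auto

lemma mat_adjoint_zero [simp]: "mat_adjoint (0\<^sub>m r c :: complex mat) = 0\<^sub>m c r"
  by (rule eq_matI) auto

lemma mat_adjoint_minus:
  fixes A :: "complex mat"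
  assumes "A \<in> carrier_mat r c" "B \<in> carrier_mat r c"
  shows "mat_adjoint (A - B) = mat_adjoint A - mat_adjoint B"
  using assms by (intro eq_matI) auto

text \<open>A rectangular version of \<open>msum\<close>: Kraus operators change the local
  dimension, so their linear combinations, in particular the isometries \<open>W a\<close>, are not
  square. Fixing the format explicitly also gives the empty sum a shape.\<close>

definition rsum :: "nat \<Rightarrow> nat \<Rightarrow> ('i \<Rightarrow> complex mat) \<Rightarrow> 'i set \<Rightarrow> complex mat" where
  "rsum r c F I = mat r c (\<lambda>ij. \<Sum>i\<in>I. F i $$ ij)"

lemma msum_rsum: "msum d = rsum d d"
  by (intro ext) (simp add: msum_def rsum_def)

lemma rsum_carrier [simp]: "rsum r c F I \<in> carrier_mat r c"
  and rsum_dim [simp]: "dim_row (rsum r c F I) = r" "dim_col (rsum r c F I) = c"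
  and rsum_index [simp]: "i < r \<Longrightarrow> j < c \<Longrightarrow> rsum r c F I $$ (i, j) = (\<Sum>l\<in>I. F l $$ (i, j))"
  by (auto simp: rsum_def)

lemma rsum_cong: "I = J \<Longrightarrow> (\<And>i. i \<in> J \<Longrightarrow> F i = G i) \<Longrightarrow> rsum r c F I = rsum r c G J"
  by (simp add: rsum_def)

lemma rsum_empty [simp]: "rsum r c F {} = 0\<^sub>m r c"
  by (rule eq_matI) auto

lemma rsum_zero:
  assumes "\<And>i. i \<in> I \<Longrightarrow> F i = 0\<^sub>m r c"
  shows "rsum r c F I = 0\<^sub>m r c"
  using assms by (intro eq_matI) auto

lemma rsum_insert:
  assumes "finite I" "i \<notin> I" "F i \<in> carrier_mat r c"
  shows "rsum r c F (insert i I) = F i + rsum r c F I"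
  using assms by (intro eq_matI) auto

lemma rsum_lessThan_Suc:
  assumes "F n \<in> carrier_mat r c"
  shows "rsum r c F {..<Suc n} = rsum r c F {..<n} + F n"
  using assms by (intro eq_matI) auto

lemma rsum_lessThan_Suc_shift:
  assumes "F 0 \<in> carrier_mat r c"
  shows "rsum r c F {..<Suc n} = F 0 + rsum r c (\<lambda>i. F (Suc i)) {..<n}"
  using assms by (intro eq_matI) (auto simp: sum.lessThan_Suc_shift simp del: sum.lessThan_Suc)

lemma rsum_delta:
  assumes "finite I" "l \<in> I" "F l \<in> carrier_mat r c"
    and "\<And>i. i \<in> I \<Longrightarrow> i \<noteq> l \<Longrightarrow> F i = 0\<^sub>m r c"
  shows "rsum r c F I = F l"
proof (rule eq_matI)
  fix i j assume "i < dim_row (F l)" "j < dim_col (F l)"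
  then have ij: "i < r" "j < c" using assms by auto
  have "(\<Sum>a\<in>I. F a $$ (i, j)) = (\<Sum>a\<in>I. if a = l then F l $$ (i, j) else 0)"
    using ij assms(4) by (intro sum.cong) auto
  then show "rsum r c F I $$ (i, j) = F l $$ (i, j)" using ij assms by simp
qed (use assms in auto)

lemma mult_rsum:
  assumes A: "A \<in> carrier_mat r n" and F: "\<And>i. i \<in> I \<Longrightarrow> F i \<in> carrier_mat n c"
  shows "A * rsum n c F I = rsum r c (\<lambda>i. A * F i) I"
proof (rule eq_matI)
  fix i j assume "i < dim_row (rsum r c (\<lambda>i. A * F i) I)" "j < dim_col (rsum r c (\<lambda>i. A * F i) I)"
  then have ij: "i < r" "j < c" by auto
  have "(A * rsum n c F I) $$ (i, j) = (\<Sum>k<n. \<Sum>l\<in>I. A $$ (i, k) * F l $$ (k, j))"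
    by (subst mat_mult_index[OF A rsum_carrier ij])
      (simp del: index_mult_mat(1) add: ij sum_distrib_left)
  also have "\<dots> = (\<Sum>l\<in>I. (A * F l) $$ (i, j))"
    by (subst sum.swap) (simp del: index_mult_mat(1) add: mat_mult_index[OF A F ij])
  finally show "(A * rsum n c F I) $$ (i, j) = rsum r c (\<lambda>i. A * F i) I $$ (i, j)"
    using ij by simp
qed (use A in auto)

lemma rsum_mult:
  assumes A: "A \<in> carrier_mat n c" and F: "\<And>i. i \<in> I \<Longrightarrow> F i \<in> carrier_mat r n"
  shows "rsum r n F I * A = rsum r c (\<lambda>i. F i * A) I"
proof (rule eq_matI)
  fix i j assume "i < dim_row (rsum r c (\<lambda>i. F i * A) I)" "j < dim_col (rsum r c (\<lambda>i. F i * A) I)"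
  then have ij: "i < r" "j < c" by auto
  have "(rsum r n F I * A) $$ (i, j) = (\<Sum>k<n. \<Sum>l\<in>I. F l $$ (i, k) * A $$ (k, j))"
    by (subst mat_mult_index[OF rsum_carrier A ij])
      (simp del: index_mult_mat(1) add: ij sum_distrib_right)
  also have "\<dots> = (\<Sum>l\<in>I. (F l * A) $$ (i, j))"
    by (subst sum.swap) (simp del: index_mult_mat(1) add: mat_mult_index[OF F A ij])
  finally show "(rsum r n F I * A) $$ (i, j) = rsum r c (\<lambda>i. F i * A) I $$ (i, j)"
    using ij by simp
qed (use A in auto)

lemma mat_adjoint_rsum:
  assumes "\<And>i. i \<in> I \<Longrightarrow> F i \<in> carrier_mat r c"
  shows "mat_adjoint (rsum r c F I) = rsum c r (\<lambda>i. mat_adjoint (F i)) I"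
  by (rule eq_matI) (auto intro!: sum.cong simp: carrier_matD[OF assms])

lemma smult_rsum:
  assumes "\<And>i. i \<in> I \<Longrightarrow> F i \<in> carrier_mat r c"
  shows "t \<cdot>\<^sub>m rsum r c F I = rsum r c (\<lambda>i. t \<cdot>\<^sub>m F i) I"
  by (rule eq_matI) (auto intro!: sum.cong simp: sum_distrib_left carrier_matD[OF assms])

section \<open>Trace and conjugation by a matrix\<close>

lemma mtrace_rsum:
  assumes "\<And>i. i \<in> I \<Longrightarrow> F i \<in> carrier_mat n n"
  shows "mtrace (rsum n n F I) = (\<Sum>i\<in>I. mtrace (F i))"
proof -
  have "mtrace (rsum n n F I) = (\<Sum>k<n. \<Sum>i\<in>I. F i $$ (k, k))"
    by (simp add: mtrace_def)
  also have "\<dots> = (\<Sum>i\<in>I. \<Sum>k<n. F i $$ (k, k))" by (rule sum.swap)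
  also have "\<dots> = (\<Sum>i\<in>I. mtrace (F i))"
    using assms by (intro sum.cong) (auto simp: mtrace_def)
  finally show ?thesis .
qed

lemma mtrace_zero [simp]: "mtrace (0\<^sub>m n n) = 0"
  by (simp add: mtrace_def)

lemma mtrace_smult [simp]: "A \<in> carrier_mat n n \<Longrightarrow> mtrace (t \<cdot>\<^sub>m A) = t * mtrace A"
  by (auto simp: mtrace_def sum_distrib_left intro!: sum.cong)

lemma mtrace_comm:
  assumes A: "A \<in> carrier_mat r c" and B: "B \<in> carrier_mat c r"
  shows "mtrace (A * B) = mtrace (B * A)"
proof -
  have "mtrace (A * B) = (\<Sum>i<r. \<Sum>k<c. A $$ (i, k) * B $$ (k, i))"
    unfolding mtrace_def using A by (simp del: index_mult_mat(1) add: mat_mult_index[OF A B])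
  also have "\<dots> = (\<Sum>k<c. \<Sum>i<r. B $$ (k, i) * A $$ (i, k))"
    by (subst sum.swap) (simp add: mult.commute)
  also have "\<dots> = mtrace (B * A)"
    unfolding mtrace_def using B by (simp del: index_mult_mat(1) add: mat_mult_index[OF B A])
  finally show ?thesis .
qed

definition sand :: "complex mat \<Rightarrow> complex mat \<Rightarrow> complex mat" where
  "sand A \<rho> = A * \<rho> * mat_adjoint A"

lemma sand_carrier [simp]: "A \<in> carrier_mat r c \<Longrightarrow> sand A \<rho> \<in> carrier_mat r r"
  by (intro carrier_matI) (simp_all add: sand_def)

lemma sand_one [simp]: "\<rho> \<in> carrier_mat n n \<Longrightarrow> sand (1\<^sub>m n) \<rho> = \<rho>"
  by (simp add: sand_def)

lemma sand_mult:
  assumes "A \<in> carrier_mat r n" "B \<in> carrier_mat n c" "\<rho> \<in> carrier_mat c c"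
  shows "sand (A * B) \<rho> = sand A (sand B \<rho>)"
proof -
  have a: "mat_adjoint A \<in> carrier_mat n r" and b: "mat_adjoint B \<in> carrier_mat c n" using assms by auto
  note A = assms(1) and B = assms(2) and R = assms(3)
  have "sand (A * B) \<rho> = (A * B * \<rho>) * (mat_adjoint B * mat_adjoint A)"
    by (simp only: sand_def mat_adjoint_mult[OF A B])
  also have "\<dots> = (A * B * \<rho>) * mat_adjoint B * mat_adjoint A"
    by (rule assoc_mult_mat[symmetric, OF mult_carrier_mat[OF mult_carrier_mat[OF A B] R] b a])
  also have "A * B * \<rho> = A * (B * \<rho>)" by (rule assoc_mult_mat[OF A B R])
  also have "A * (B * \<rho>) * mat_adjoint B = A * (B * \<rho> * mat_adjoint B)"
    by (rule assoc_mult_mat[OF A mult_carrier_mat[OF B R] b])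
  finally show ?thesis by (simp only: sand_def)
qed

lemma sand_add:
  assumes "A \<in> carrier_mat r c" "\<rho> \<in> carrier_mat c c" "\<sigma> \<in> carrier_mat c c"
  shows "sand A (\<rho> + \<sigma>) = sand A \<rho> + sand A \<sigma>"
  unfolding sand_def using assms
  by (simp add: mult_add_distrib_mat[of _ r c _ c] add_mult_distrib_mat[of _ r c _ _ r])

lemma sand_smult:
  assumes "A \<in> carrier_mat r c" "\<rho> \<in> carrier_mat c c"
  shows "sand A (t \<cdot>\<^sub>m \<rho>) = t \<cdot>\<^sub>m sand A \<rho>"
  unfolding sand_def using assms
  by (simp add: mult_smult_distrib[of _ r c _ c] mult_smult_assoc_mat[of _ r c _ r])

lemma sand_zero [simp]:
  assumes "A \<in> carrier_mat r c"
  shows "sand A (0\<^sub>m c c) = 0\<^sub>m r r"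
  unfolding sand_def using assms by (simp add: right_mult_zero_mat[of _ r c] left_mult_zero_mat[of _ c r])

lemma sand_rsum:
  assumes "A \<in> carrier_mat r c" "\<And>i. i \<in> I \<Longrightarrow> F i \<in> carrier_mat c c"
  shows "sand A (rsum c c F I) = rsum r r (\<lambda>i. sand A (F i)) I"
  unfolding sand_def using assms
  by (simp add: mult_rsum[of _ r c] rsum_mult[of _ c r])

lemma mtrace_sand:
  assumes "A \<in> carrier_mat r c" "\<rho> \<in> carrier_mat c c"
  shows "mtrace (sand A \<rho>) = mtrace (mat_adjoint A * A * \<rho>)"
proof -
  have [simp]: "mat_adjoint A \<in> carrier_mat c r" using assms by auto
  have "mtrace (sand A \<rho>) = mtrace (mat_adjoint A * (A * \<rho>))"
    unfolding sand_def using assms by (intro mtrace_comm[of _ r c]) auto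
  also have "mat_adjoint A * (A * \<rho>) = mat_adjoint A * A * \<rho>"
    using assms by (simp add: assoc_mult_mat[of _ c r _ c _ c])
  finally show ?thesis .
qed

lemma mtrace_sand_isometry:
  assumes "A \<in> carrier_mat r c" "\<rho> \<in> carrier_mat c c" "mat_adjoint A * A = 1\<^sub>m c"
  shows "mtrace (sand A \<rho>) = mtrace \<rho>"
  using assms by (simp add: mtrace_sand[OF assms(1,2)])

section \<open>Kronecker products\<close>

lemma kron_dim [simp]: "dim_row (kron A B) = dim_row A * dim_row B" "dim_col (kron A B) = dim_col A * dim_col B"
  by (auto simp: kron_def)

lemma kron_carrier [simp]:
  "A \<in> carrier_mat a b \<Longrightarrow> B \<in> carrier_mat c d \<Longrightarrow> kron A B \<in> carrier_mat (a * c) (b * d)"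
  by (intro carrier_matI) simp_all

lemma kron_index:
  assumes "i < dim_row A * dim_row B" "j < dim_col A * dim_col B"
  shows "kron A B $$ (i, j) = A $$ (i div dim_row B, j div dim_col B) * B $$ (i mod dim_row B, j mod dim_col B)"
  using assms by (simp add: kron_def)

lemma div_mod_less:
  fixes i a b :: nat
  assumes "i < a * b"
  shows "i div b < a" "i mod b < b"
proof -
  show "i div b < a" using assms by (simp add: less_mult_imp_div_less)
  show "i mod b < b" using assms by (cases b) auto
qed

text \<open>The flat index of a tensor product encodes the pair (a, b) as \<open>a * n + b\<close>;
  summing over flat indices is summing over pairs.\<close>

lemma sum_div_mod:
  fixes h :: "nat \<Rightarrow> nat \<Rightarrow> complex"
  shows "(\<Sum>k<m * n. h (k div n) (k mod n)) = (\<Sum>a<m. \<Sum>b<n. h a b)"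
proof -
  have "(\<Sum>k<m * n. h (k div n) (k mod n)) = (\<Sum>(a, b)\<in>{..<m} \<times> {..<n}. h a b)"
  proof (rule sum.reindex_bij_witness[of _ "\<lambda>(a, b). a * n + b" "\<lambda>k. (k div n, k mod n)"])
    fix x assume "x \<in> {..<m} \<times> {..<n}"
    then obtain a b where x: "x = (a, b)" "a < m" "b < n" by auto
    have "a * n + b < Suc a * n" using x by simp
    also have "\<dots> \<le> m * n" using x by (intro mult_right_mono) auto
    finally show "(case x of (a, b) \<Rightarrow> a * n + b) \<in> {..<m * n}" using x by simp
  qed (auto simp: div_mod_less)
  then show ?thesis by (simp add: sum.cartesian_product)
qed

lemma kron_mult:
  assumes A: "A \<in> carrier_mat a n" and B: "B \<in> carrier_mat b m"
    and C: "C \<in> carrier_mat n c" and D: "D \<in> carrier_mat m d"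
  shows "kron A B * kron C D = kron (A * C) (B * D)"
proof (rule eq_matI)
  fix i j assume "i < dim_row (kron (A * C) (B * D))" "j < dim_col (kron (A * C) (B * D))"
  then have ij: "i < a * b" "j < c * d" using A B C D by auto
  note dm = div_mod_less[OF ij(1)] div_mod_less[OF ij(2)]
  have "(kron A B * kron C D) $$ (i, j) = (\<Sum>k<n * m. kron A B $$ (i, k) * kron C D $$ (k, j))"
    using A B C D by (intro mat_mult_index[OF _ _ ij]) auto
  also have "\<dots> = (\<Sum>k<n * m. (\<lambda>x y. A $$ (i div b, x) * B $$ (i mod b, y) *
      (C $$ (x, j div d) * D $$ (y, j mod d))) (k div m) (k mod m))"
    using A B C D ij by (intro sum.cong) (auto simp: kron_index)
  also have "\<dots> = (\<Sum>x<n. \<Sum>y<m. A $$ (i div b, x) * B $$ (i mod b, y) *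
      (C $$ (x, j div d) * D $$ (y, j mod d)))"
    by (rule sum_div_mod)
  also have "\<dots> = (\<Sum>x<n. A $$ (i div b, x) * C $$ (x, j div d)) *
      (\<Sum>y<m. B $$ (i mod b, y) * D $$ (y, j mod d))"
    by (simp add: sum_product algebra_simps)
  also have "\<dots> = (A * C) $$ (i div b, j div d) * (B * D) $$ (i mod b, j mod d)"
    using dm by (simp del: index_mult_mat(1) add: mat_mult_index[OF A C] mat_mult_index[OF B D])
  also have "\<dots> = kron (A * C) (B * D) $$ (i, j)"
    using A B C D ij by (subst kron_index) auto
  finally show "(kron A B * kron C D) $$ (i, j) = kron (A * C) (B * D) $$ (i, j)" .
qed (use A B C D in auto)

lemma kron_assoc: "kron (kron A B) C = kron A (kron B C)"
proof (rule eq_matI)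
  fix i j assume "i < dim_row (kron A (kron B C))" "j < dim_col (kron A (kron B C))"
  then have ij: "i < dim_row A * dim_row B * dim_row C" "j < dim_col A * dim_col B * dim_col C"
    by (auto simp: mult.assoc)
  note 1 = div_mod_less[OF ij(1)] div_mod_less[OF ij(2)]
  have ij': "i < dim_row A * (dim_row B * dim_row C)" "j < dim_col A * (dim_col B * dim_col C)"
    using ij by (auto simp: mult.assoc)
  note 2 = div_mod_less[OF ij'(1)] div_mod_less[OF ij'(2)]
  \<comment> \<open>A flat index has three mixed-radix digits here. These identities show that both
    bracketings read off the same digits.\<close>
  have aux: "(x mod (p * q)) div q = (x div q) mod p" "(x mod (p * q)) mod q = x mod q"
    "x div (p * q) = x div q div p" if "x < r * p * q" for x p q r :: nat
  proof -
    have "x mod (p * q) = q * (x div q mod p) + x mod q" using mod_mult2_eq[of x q p] by (simp add: mult.commute)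
    moreover have "x mod q < q" using that by (cases q) auto
    ultimately show "(x mod (p * q)) div q = (x div q) mod p" "(x mod (p * q)) mod q = x mod q" by auto
    show "x div (p * q) = x div q div p" using div_mult2_eq[of x q p] by (simp add: mult.commute)
  qed
  have "kron (kron A B) C $$ (i, j) =
     A $$ (i div dim_row C div dim_row B, j div dim_col C div dim_col B) *
     B $$ (i div dim_row C mod dim_row B, j div dim_col C mod dim_col B) *
     C $$ (i mod dim_row C, j mod dim_col C)"
    using ij 1 by (simp add: kron_index)
  also have "\<dots> = kron A (kron B C) $$ (i, j)"
    using ij' 2 by (simp add: kron_index aux(1,2,3)[OF ij(1)] aux(1,2,3)[OF ij(2)])
  finally show "kron (kron A B) C $$ (i, j) = kron A (kron B C) $$ (i, j)" .
qed (auto simp: mult.assoc)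

lemma kron_one [simp]: "kron (1\<^sub>m a) (1\<^sub>m b) = 1\<^sub>m (a * b)"
proof (rule eq_matI)
  fix i j assume "i < dim_row (1\<^sub>m (a * b))" "j < dim_col (1\<^sub>m (a * b))"
  then have ij: "i < a * b" "j < a * b" by auto
  have "i = j \<longleftrightarrow> i div b = j div b \<and> i mod b = j mod b"
    by (metis div_mult_mod_eq)
  then show "kron (1\<^sub>m a) (1\<^sub>m b) $$ (i, j) = 1\<^sub>m (a * b) $$ (i, j)"
    using ij div_mod_less[OF ij(1)] div_mod_less[OF ij(2)] by (simp add: kron_index)
qed auto

lemma kron_one_left [simp]: "kron (1\<^sub>m 1) A = A"
  by (rule eq_matI) (auto simp: kron_index)

lemma kron_one_right [simp]: "kron A (1\<^sub>m 1) = A"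
  by (rule eq_matI) (auto simp: kron_index)

lemma kron_adjoint: "mat_adjoint (kron A B) = kron (mat_adjoint A) (mat_adjoint B)"
  by (rule eq_matI) (auto simp: kron_index div_mod_less)

lemma kron_smult_right: "kron A (t \<cdot>\<^sub>m B) = t \<cdot>\<^sub>m kron A B"
  by (rule eq_matI) (auto simp: kron_index div_mod_less)

lemma kron_smult_left: "kron (t \<cdot>\<^sub>m A) B = t \<cdot>\<^sub>m kron A B"
  by (rule eq_matI) (auto simp: kron_index div_mod_less)

lemma kron_rsum_right:
  assumes "\<And>i. i \<in> I \<Longrightarrow> F i \<in> carrier_mat r c" "A \<in> carrier_mat a b"
  shows "kron A (rsum r c F I) = rsum (a * r) (b * c) (\<lambda>i. kron A (F i)) I"
  by (rule eq_matI)
    (auto simp: kron_index div_mod_less sum_distrib_left carrier_matD[OF assms(1)] carrier_matD[OF assms(2)] intro!: sum.cong)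

lemma kron_rsum_left:
  assumes "\<And>i. i \<in> I \<Longrightarrow> F i \<in> carrier_mat r c" "A \<in> carrier_mat a b"
  shows "kron (rsum r c F I) A = rsum (r * a) (c * b) (\<lambda>i. kron (F i) A) I"
  by (rule eq_matI)
    (auto simp: kron_index div_mod_less sum_distrib_right carrier_matD[OF assms(1)] carrier_matD[OF assms(2)] intro!: sum.cong)

section \<open>Operators acting on a single party\<close>

lemma tdim_update: "k < length ds \<Longrightarrow>
    tdim (ds[k := e]) = prod_list (take k ds) * (e * prod_list (drop (Suc k) ds))"
  by (simp add: upd_conv_take_nth_drop)

lemma tdim_split: "k < length ds \<Longrightarrow>
    tdim ds = prod_list (take k ds) * (ds ! k * prod_list (drop (Suc k) ds))"
  using tdim_update[of k ds "ds ! k"] by simp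

text \<open>Only the dimensions of the other parties enter \<open>loc\<close>. Thus operators on
  party k can be composed although each of them changes the dimension of that party.\<close>

lemma loc_update [simp]: "loc (ds[k := e]) k = loc ds k"
  by (intro ext) (simp add: loc_def)

lemma loc_carrier [simp]:
  assumes "k < length ds" "K \<in> carrier_mat a b"
  shows "loc ds k K \<in> carrier_mat (tdim (ds[k := a])) (tdim (ds[k := b]))"
  unfolding loc_def tdim_update[OF assms(1)] using assms(2) by (intro kron_carrier) auto

lemma loc_carrier' [simp]:
  assumes "k < length ds" "K \<in> carrier_mat a (ds ! k)"
  shows "loc ds k K \<in> carrier_mat (tdim (ds[k := a])) (tdim ds)"
  using loc_carrier[OF assms] by simp

lemma loc_mult:
  assumes A: "A \<in> carrier_mat a b" and B: "B \<in> carrier_mat b c"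
  shows "loc ds k A * loc ds k B = loc ds k (A * B)"
proof -
  let ?P = "prod_list (take k ds)" and ?Q = "prod_list (drop (Suc k) ds)"
  have 1: "kron A (1\<^sub>m ?Q) * kron B (1\<^sub>m ?Q) = kron (A * B) (1\<^sub>m ?Q)"
    by (subst kron_mult[OF A one_carrier_mat B one_carrier_mat]) simp
  show ?thesis unfolding loc_def
    by (subst kron_mult[OF one_carrier_mat kron_carrier[OF A one_carrier_mat]
          one_carrier_mat kron_carrier[OF B one_carrier_mat]]) (simp add: 1)
qed

lemma loc_adjoint: "mat_adjoint (loc ds k A) = loc ds k (mat_adjoint A)"
  by (simp add: loc_def kron_adjoint)

lemma loc_one [simp]: "k < length ds \<Longrightarrow> loc ds k (1\<^sub>m e) = 1\<^sub>m (tdim (ds[k := e]))"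
  by (simp add: loc_def tdim_update)

lemma loc_smult: "loc ds k (t \<cdot>\<^sub>m A) = t \<cdot>\<^sub>m loc ds k A"
  by (simp add: loc_def kron_smult_left kron_smult_right)

lemma loc_rsum:
  assumes k: "k < length ds" and F: "\<And>i. i \<in> I \<Longrightarrow> F i \<in> carrier_mat a b"
  shows "loc ds k (rsum a b F I) = rsum (tdim (ds[k := a])) (tdim (ds[k := b])) (\<lambda>i. loc ds k (F i)) I"
proof -
  let ?P = "prod_list (take k ds)" and ?Q = "prod_list (drop (Suc k) ds)"
  have "kron (rsum a b F I) (1\<^sub>m ?Q) = rsum (a * ?Q) (b * ?Q) (\<lambda>i. kron (F i) (1\<^sub>m ?Q)) I"
    using F by (intro kron_rsum_left) auto
  then show ?thesis unfolding loc_def tdim_update[OF k]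
    by (simp only:) (rule kron_rsum_right[OF kron_carrier[OF F one_carrier_mat] one_carrier_mat])
qed

lemma loc_zero [simp]: "k < length ds \<Longrightarrow> loc ds k (0\<^sub>m a b) = 0\<^sub>m (tdim (ds[k := a])) (tdim (ds[k := b]))"
  using loc_rsum[of k ds "{}" "\<lambda>_. 0\<^sub>m a b" a b] by simp

lemma sand_loc_mult:
  assumes k: "k < length ds" and A: "A \<in> carrier_mat a b" and B: "B \<in> carrier_mat b c"
    and \<rho>: "\<rho> \<in> carrier_mat (tdim (ds[k := c])) (tdim (ds[k := c]))"
  shows "sand (loc ds k (A * B)) \<rho> = sand (loc ds k A) (sand (loc ds k B) \<rho>)"
  using sand_mult[OF loc_carrier[OF k A] loc_carrier[OF k B] \<rho>] by (simp add: loc_mult[OF A B])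

lemma loc_isometry:
  assumes "k < length ds" "V \<in> carrier_mat a b" "mat_adjoint V * V = 1\<^sub>m b"
  shows "mat_adjoint (loc ds k V) * loc ds k V = 1\<^sub>m (tdim (ds[k := b]))"
  using assms by (simp add: loc_adjoint loc_mult[of _ b a _ b])

section \<open>Tensor products with one factor per party\<close>

lemma kron_list_append: "kron_list (As @ Bs) = kron (kron_list As) (kron_list Bs)"
  by (induction As) (simp_all del: One_nat_def add: kron_assoc)

lemma kron_list_ones [simp]: "kron_list (map 1\<^sub>m ds) = 1\<^sub>m (prod_list ds)"
  by (induction ds) auto

text \<open>[LUI] speaks of one unitary per party; padding with identities makes it applicable to a
  single party.\<close>

lemma kron_list_loc:
  "kron_list (map 1\<^sub>m (take k ds) @ U # map 1\<^sub>m (drop (Suc k) ds)) = loc ds k U"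
  by (simp add: kron_list_append loc_def)

lemma kron_list_carrier:
  assumes "length Us = length ds" "\<And>k. k < length ds \<Longrightarrow> Us ! k \<in> carrier_mat (ds ! k) (ds ! k)"
  shows "kron_list Us \<in> carrier_mat (tdim ds) (tdim ds)"
  using assms
proof (induction Us ds rule: list_induct2)
  case (Cons U Us d ds)
  have "kron_list Us \<in> carrier_mat (tdim ds) (tdim ds)"
    by (rule Cons.IH) (use Cons.prems[of "Suc _"] in auto)
  moreover have "U \<in> carrier_mat d d" using Cons.prems[of 0] by simp
  ultimately show ?case by simp
qed simp

section \<open>Positive semidefinite matrices\<close>

lemma psd_carrier [simp]: "psd d A \<Longrightarrow> A \<in> carrier_mat d d"
  by (simp add: psd_def)

lemma quad_form:
  assumes A: "A \<in> carrier_mat d d" and v: "v \<in> carrier_vec d"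
  shows "conjugate v \<bullet> (A *\<^sub>v v) = (\<Sum>i<d. cnj (v $ i) * (\<Sum>j<d. v $ j * A $$ (i, j)))"
  using assms by (auto simp: scalar_prod_def atLeast0LessThan mult.commute intro!: sum.cong)

text \<open>The quadratic form at the vector \<open>e_i + t e_j\<close> involves only four entries
  of the matrix. Different choices of t then extract information on the diagonal and on the
  off-diagonal pair.\<close>

lemma psd_two_point:
  assumes psd: "psd d A" and ij: "i < d" "j < d"
  defines "z t \<equiv> A $$ (i, i) + t * A $$ (i, j) + cnj t * (A $$ (j, i) + t * A $$ (j, j))"
  shows "Im (z t) = 0" "0 \<le> Re (z t)"
proof -
  define v where "v = vec d (\<lambda>k. (if k = i then 1 else 0) + t * (if k = j then 1 else 0))"
  have v: "v \<in> carrier_vec d" by (simp add: v_def)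
  have s: "(\<Sum>k<d. ((if k = i then 1 else 0) + u * (if k = j then 1 else 0)) * x k) = x i + u * x j"
    for u :: complex and x
  proof -
    have "(\<Sum>k<d. ((if k = i then 1 else 0) + u * (if k = j then 1 else 0)) * x k)
      = (\<Sum>k<d. (if k = i then x k else 0) + (if k = j then u * x k else 0))"
      by (intro sum.cong) (auto simp: algebra_simps)
    then show ?thesis using ij by (simp add: sum.distrib algebra_simps)
  qed
  have "conjugate v \<bullet> (A *\<^sub>v v) =
     (\<Sum>a<d. ((if a = i then 1 else 0) + cnj t * (if a = j then 1 else 0)) *
     (\<Sum>b<d. ((if b = i then 1 else 0) + t * (if b = j then 1 else 0)) * A $$ (a, b)))"
    using psd by (subst quad_form[OF _ v]) (auto simp: v_def intro!: sum.cong)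
  also have "\<dots> = z t" unfolding s by (simp add: z_def)
  finally have "conjugate v \<bullet> (A *\<^sub>v v) = z t" .
  then show "Im (z t) = 0" "0 \<le> Re (z t)" using psd v unfolding psd_def by (metis, metis)
qed

lemma psd_diag:
  assumes "psd d A" "i < d"
  shows "Im (A $$ (i, i)) = 0" "0 \<le> Re (A $$ (i, i))"
  using psd_two_point[OF assms assms(2), of 0] by auto

lemma psd_trace:
  assumes "psd d A"
  shows "mtrace A = complex_of_real (Re (mtrace A))" "0 \<le> Re (mtrace A)"
proof -
  have "dim_row A = d" using assms by (auto simp: psd_def)
  then show "mtrace A = complex_of_real (Re (mtrace A))" "0 \<le> Re (mtrace A)"
    using psd_diag[OF assms] by (auto simp: mtrace_def complex_eq_iff intro!: sum_nonneg sum.neutral)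
qed

text \<open>Needed for outcomes of probability zero: their unnormalised state is the zero matrix, so
  they drop out of all sums.\<close>

lemma psd_trace_zero:
  assumes psd: "psd d A" and tr: "Re (mtrace A) = 0"
  shows "A = 0\<^sub>m d d"
proof (rule eq_matI)
  fix i j assume "i < dim_row (0\<^sub>m d d)" "j < dim_col (0\<^sub>m d d)"
  then have ij: "i < d" "j < d" by auto
  have dim: "dim_row A = d" using psd by (auto simp: psd_def)
  have "(\<Sum>i<d. Re (A $$ (i, i))) = 0" using tr dim by (simp add: mtrace_def)
  then have "\<forall>i\<in>{..<d}. Re (A $$ (i, i)) = 0"
    using psd_diag[OF psd] by (subst (asm) sum_nonneg_eq_0_iff) auto
  then have 0: "A $$ (l, l) = 0" if "l < d" for l
    using psd_diag[OF psd that] that by (simp add: complex_eq_iff)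
  note tp = psd_two_point[OF psd ij]
  \<comment> \<open>With zero diagonal the form is \<open>t * A_ij + cnj t * A_ji\<close>. Reality
    and nonnegativity at t and -t make it vanish; t = 1 gives \<open>A_ij + A_ji = 0\<close>, and t
    = \<i> gives \<open>A_ij - A_ji = 0\<close>.\<close>
  show "A $$ (i, j) = 0\<^sub>m d d $$ (i, j)"
    using tp[of 1] tp[of "-1"] tp[of \<i>] tp[of "-\<i>"] ij
    by (simp add: 0 complex_eq_iff)
qed (use psd in \<open>auto simp: psd_def\<close>)

lemma psd_zero [simp]: "psd d (0\<^sub>m d d)"
  by (simp add: psd_def quad_form[OF zero_carrier_mat])

lemma psd_add:
  assumes "psd d A" "psd d B"
  shows "psd d (A + B)"
proof -
  have AB: "A \<in> carrier_mat d d" "B \<in> carrier_mat d d" using assms by auto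
  have "conjugate v \<bullet> ((A + B) *\<^sub>v v) = conjugate v \<bullet> (A *\<^sub>v v) + conjugate v \<bullet> (B *\<^sub>v v)"
    if v: "v \<in> carrier_vec d" for v
    unfolding add_mult_distrib_mat_vec[OF AB v] using AB v
    by (intro scalar_prod_add_distrib[of _ d]) auto
  then show ?thesis using assms unfolding psd_def by auto
qed

lemma psd_smult:
  assumes "psd d A" "0 \<le> t"
  shows "psd d (complex_of_real t \<cdot>\<^sub>m A)"
proof -
  have A: "A \<in> carrier_mat d d" using assms by auto
  have "conjugate v \<bullet> ((complex_of_real t \<cdot>\<^sub>m A) *\<^sub>v v) = complex_of_real t * (conjugate v \<bullet> (A *\<^sub>v v))"
    if v: "v \<in> carrier_vec d" for v
    unfolding quad_form[OF A v] quad_form[OF smult_carrier_mat[OF A] v] sum_distrib_left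
    using A by (auto simp: mult_ac intro!: sum.cong)
  then show ?thesis using assms unfolding psd_def by auto
qed

lemma psd_sand:
  assumes psd: "psd c A" and K: "K \<in> carrier_mat r c"
  shows "psd r (sand K A)"
proof -
  have A: "A \<in> carrier_mat c c" using psd by auto
  have "conjugate v \<bullet> (sand K A *\<^sub>v v) =
      conjugate (mat_adjoint K *\<^sub>v v) \<bullet> (A *\<^sub>v (mat_adjoint K *\<^sub>v v))"
    if v: "v \<in> carrier_vec r" for v
  proof -
    define w where "w = A *\<^sub>v (mat_adjoint K *\<^sub>v v)"
    have w: "w \<in> carrier_vec c" unfolding w_def using mult_mat_vec_carrier[OF A mult_mat_vec_carrier[OF mat_adjoint_carrier[OF K] v]] .
    have "sand K A *\<^sub>v v = K *\<^sub>v w"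
      unfolding sand_def w_def using A K v
      by (simp add: assoc_mult_mat_vec[of _ r c _ r] assoc_mult_mat_vec[of K r c A c "mat_adjoint K *\<^sub>v v"] mult_mat_vec_carrier[OF mat_adjoint_carrier[OF K] v])
    moreover have "conjugate v \<bullet> (K *\<^sub>v w) = conjugate (mat_adjoint K *\<^sub>v v) \<bullet> w"
    proof -
      have "conjugate v \<bullet> (K *\<^sub>v w) = (\<Sum>i<r. \<Sum>j<c. cnj (v $ i) * K $$ (i, j) * w $ j)"
        using K v w by (auto simp: scalar_prod_def atLeast0LessThan sum_distrib_left mult.assoc intro!: sum.cong)
      also have "\<dots> = (\<Sum>j<c. \<Sum>i<r. cnj (v $ i) * K $$ (i, j) * w $ j)" by (rule sum.swap)
      also have "\<dots> = conjugate (mat_adjoint K *\<^sub>v v) \<bullet> w"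
        using K v w by (auto simp: scalar_prod_def atLeast0LessThan sum_distrib_left sum_distrib_right mult_ac intro!: sum.cong)
      finally show ?thesis .
    qed
    ultimately show ?thesis by (simp add: w_def)
  qed
  moreover have "mat_adjoint K *\<^sub>v v \<in> carrier_vec c" if "v \<in> carrier_vec r" for v
    by (rule mult_mat_vec_carrier[OF mat_adjoint_carrier[OF K] that])
  ultimately show ?thesis using psd K unfolding psd_def by auto
qed

lemma psd_rsum:
  assumes "finite I" "\<And>i. i \<in> I \<Longrightarrow> psd d (F i)"
  shows "psd d (rsum d d F I)"
  using assms
proof (induction I rule: finite_induct)
  case (insert i I)
  then show ?case by (simp add: rsum_insert psd_add)
qed simp

lemma density_normalized:
  assumes "psd d A" "0 < Re (mtrace A)"
  shows "density d (complex_of_real (1 / Re (mtrace A)) \<cdot>\<^sub>m A)"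
proof -
  have "psd d (complex_of_real (1 / Re (mtrace A)) \<cdot>\<^sub>m A)"
    by (intro psd_smult assms) (use assms in auto)
  moreover have "mtrace (complex_of_real (1 / Re (mtrace A)) \<cdot>\<^sub>m A) = 1"
    using assms(2) psd_trace(1)[OF assms(1)] mtrace_smult[OF psd_carrier[OF assms(1)]]
    by (metis divide_self less_irrefl of_real_1 of_real_mult times_divide_eq_left mult_1)
  ultimately show ?thesis by (simp add: density_def)
qed

section \<open>Homogeneous extension to positive semidefinite matrices\<close>

text \<open>At the unnormalised output of an outcome this is exactly \<open>out_prob\<close> times
  \<open>f\<close> of \<open>out_state\<close>. For trace 0 the division yields 0 and
  \<open>f\<close> is evaluated at a matrix that is no state, but the factor in front makes the
  value 0.\<close>

definition homog :: "(nat list \<Rightarrow> complex mat \<Rightarrow> real) \<Rightarrow> nat list \<Rightarrow> complex mat \<Rightarrow> real" where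
  "homog f ds A = Re (mtrace A) * f ds (complex_of_real (1 / Re (mtrace A)) \<cdot>\<^sub>m A)"

lemma homog_zero [simp]: "homog f ds (0\<^sub>m n n) = 0"
  by (simp add: homog_def)

lemma homog_trace_one:
  assumes "mtrace A = 1"
  shows "homog f ds A = f ds A"
proof -
  have "1 \<cdot>\<^sub>m A = A" by (rule eq_matI) auto
  then show ?thesis by (simp add: homog_def assms)
qed

lemma homog_smult:
  assumes A: "A \<in> carrier_mat n n" and t: "0 \<le> t"
  shows "homog f ds (complex_of_real t \<cdot>\<^sub>m A) = t * homog f ds A"
proof (cases "t = 0")
  case False
  have "complex_of_real (1 / (t * r)) \<cdot>\<^sub>m (complex_of_real t \<cdot>\<^sub>m A) = complex_of_real (1 / r) \<cdot>\<^sub>m A" for r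
    using False by (intro eq_matI) auto
  then show ?thesis using A by (simp add: homog_def mult.assoc)
next
  case True
  then have "complex_of_real t \<cdot>\<^sub>m A = 0\<^sub>m n n" using A by (intro eq_matI) auto
  then show ?thesis using True by simp
qed

text \<open>\<open>convex_fun\<close> and \<open>FLAGS\<close> ask for genuine states even where the
  weight is 0, so a family of positive semidefinite matrices has to be rewritten as a total trace T
  times an ensemble. The ensemble does not depend on \<open>f\<close>, so the same one serves for
  every function and every system.\<close>

lemma psd_mixture:
  fixes n :: nat
  assumes psd: "\<And>i. i < n \<Longrightarrow> psd d (A i)" and T: "T = (\<Sum>i<n. Re (mtrace (A i)))" and pos: "0 < T"
  obtains \<rho> p where "\<And>i. i < n \<Longrightarrow> density d (\<rho> i)" "\<And>i. i < n \<Longrightarrow> 0 \<le> p i" "(\<Sum>i<n. p i) = 1"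
    "\<And>i. i < n \<Longrightarrow> A i = complex_of_real T \<cdot>\<^sub>m (complex_of_real (p i) \<cdot>\<^sub>m \<rho> i)"
    "\<And>i f ds. i < n \<Longrightarrow> homog f ds (A i) = T * (p i * f ds (\<rho> i))"
proof -
  obtain l where l: "l < n" "0 < Re (mtrace (A l))"
    using pos unfolding T by (metis lessThan_iff not_le sum_nonpos)
  \<comment> \<open>A placeholder for the members of weight 0, which cannot be normalised; some
    member has positive trace because the total is positive.\<close>
  define \<rho>0 where "\<rho>0 = complex_of_real (1 / Re (mtrace (A l))) \<cdot>\<^sub>m A l"
  have \<rho>0: "density d \<rho>0" unfolding \<rho>0_def by (intro density_normalized psd l)
  define p where "p i = Re (mtrace (A i)) / T" for i
  define \<rho> where "\<rho> i = (if p i = 0 then \<rho>0 else complex_of_real (1 / Re (mtrace (A i))) \<cdot>\<^sub>m A i)" for i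
  have tr: "0 \<le> Re (mtrace (A i))" if "i < n" for i using psd_trace(2)[OF psd[OF that]] .
  have p0: "p i = 0 \<longleftrightarrow> Re (mtrace (A i)) = 0" for i using pos by (simp add: p_def)
  have dens: "density d (\<rho> i)" if "i < n" for i
    using \<rho>0 density_normalized[OF psd[OF that]] tr[OF that] by (auto simp: \<rho>_def p0 less_le)
  show ?thesis
  proof (rule that[of \<rho> p])
    show "(\<Sum>i<n. p i) = 1" using pos by (simp add: p_def T flip: sum_divide_distrib)
    fix i assume i: "i < n"
    show "density d (\<rho> i)" by (rule dens[OF i])
    show "0 \<le> p i" using tr[OF i] pos by (simp add: p_def)
    have c: "A i \<in> carrier_mat d d" "\<rho> i \<in> carrier_mat d d"
      using psd[OF i] dens[OF i] by (auto simp: density_def)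
    show "A i = complex_of_real T \<cdot>\<^sub>m (complex_of_real (p i) \<cdot>\<^sub>m \<rho> i)"
    proof (cases "p i = 0")
      case True
      then have "A i = 0\<^sub>m d d" using psd_trace_zero[OF psd[OF i]] p0 by blast
      then show ?thesis using c True by (intro eq_matI) auto
    next
      case False
      then show ?thesis using pos p0[of i] by (intro eq_matI) (auto simp: \<rho>_def p_def)
    qed
    show "homog f ds (A i) = T * (p i * f ds (\<rho> i))" for f ds
      using pos p0[of i] by (simp add: homog_def \<rho>_def p_def)
  qed
qed

text \<open>If the total trace T vanishes, every summand is the zero matrix and both sides are 0.
  Otherwise this is convexity for the ensemble of \<open>psd_mixture\<close>, multiplied by
  T.\<close>

lemma homog_convex:
  fixes n :: nat
  assumes conv: "convex_fun N f" and len: "length ds = N"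
    and psd: "\<And>i. i < n \<Longrightarrow> psd (tdim ds) (A i)"
  shows "homog f ds (rsum (tdim ds) (tdim ds) A {..<n}) \<le> (\<Sum>i<n. homog f ds (A i))"
proof -
  define T where "T = (\<Sum>i<n. Re (mtrace (A i)))"
  have tr: "0 \<le> Re (mtrace (A i))" if "i < n" for i using psd_trace(2)[OF psd[OF that]] .
  show ?thesis
  proof (cases "T = 0")
    case True
    then have "\<forall>i\<in>{..<n}. Re (mtrace (A i)) = 0"
      unfolding T_def using sum_nonneg_eq_0_iff[of "{..<n}" "\<lambda>i. Re (mtrace (A i))"] tr by simp
    then have "A i = 0\<^sub>m (tdim ds) (tdim ds)" if "i \<in> {..<n}" for i
      using psd_trace_zero[OF psd] that by blast
    then have "rsum (tdim ds) (tdim ds) A {..<n} = 0\<^sub>m (tdim ds) (tdim ds)"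
      "(\<Sum>i<n. homog f ds (A i)) = 0"
      by (auto intro: rsum_zero)
    then show ?thesis by simp
  next
    case False
    then have pos: "0 < T" using tr by (auto simp: T_def less_le intro!: sum_nonneg)
    obtain \<rho> p where d: "\<And>i. i < n \<Longrightarrow> density (tdim ds) (\<rho> i)" "\<And>i. i < n \<Longrightarrow> 0 \<le> p i" "(\<Sum>i<n. p i) = 1"
      and A: "\<And>i. i < n \<Longrightarrow> A i = complex_of_real T \<cdot>\<^sub>m (complex_of_real (p i) \<cdot>\<^sub>m \<rho> i)"
      and h: "\<And>i f ds. i < n \<Longrightarrow> homog f ds (A i) = T * (p i * f ds (\<rho> i))"
      by (rule psd_mixture[of n "tdim ds" A, OF _ T_def pos]) (use psd in blast, rule that)
    have c: "complex_of_real (p i) \<cdot>\<^sub>m \<rho> i \<in> carrier_mat (tdim ds) (tdim ds)" if "i < n" for i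
      using d(1)[OF that] by (auto simp: density_def)
    let ?M = "rsum (tdim ds) (tdim ds) (\<lambda>i. complex_of_real (p i) \<cdot>\<^sub>m \<rho> i) {..<n}"
    have "rsum (tdim ds) (tdim ds) A {..<n} = complex_of_real T \<cdot>\<^sub>m ?M"
      by (subst smult_rsum) (auto simp: c A intro!: rsum_cong)
    then have "homog f ds (rsum (tdim ds) (tdim ds) A {..<n}) = T * homog f ds ?M"
      using pos by (simp add: homog_smult[OF rsum_carrier])
    also have "mtrace ?M = 1"
    proof -
      have "mtrace ?M = (\<Sum>i<n. mtrace (complex_of_real (p i) \<cdot>\<^sub>m \<rho> i))"
        by (intro mtrace_rsum) (simp add: c)
      also have "\<dots> = (\<Sum>i<n. complex_of_real (p i) * mtrace (\<rho> i))"
        using d(1) by (intro sum.cong mtrace_smult[of _ "tdim ds"]) (auto simp: density_def)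
      also have "\<dots> = 1" using d(1,3) by (simp add: density_def flip: of_real_sum)
      finally show ?thesis .
    qed
    then have "T * homog f ds ?M = T * f ds ?M" by (simp add: homog_trace_one)
    also have "f ds ?M \<le> (\<Sum>i<n. p i * f ds (\<rho> i))"
      using conv len d unfolding convex_fun_def mstate_def msum_rsum by blast
    then have "T * f ds ?M \<le> T * (\<Sum>i<n. p i * f ds (\<rho> i))" using pos by simp
    also have "\<dots> = (\<Sum>i<n. homog f ds (A i))" by (simp add: h sum_distrib_left)
    finally show ?thesis .
  qed
qed

section \<open>Flags and local unitaries\<close>

definition flag_op :: "nat \<Rightarrow> nat \<Rightarrow> complex vec \<Rightarrow> complex mat" where
  "flag_op d m x = kron (1\<^sub>m d) (mat m 1 (\<lambda>(r, _). x $ r))"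

lemma flag_iso_loc: "flag_iso ds k m x = loc ds k (flag_op (ds ! k) m x)"
  by (simp add: flag_iso_def flag_op_def)

lemma flag_op_carrier [simp]: "flag_op d m x \<in> carrier_mat (d * m) d"
proof -
  have "mat m 1 (\<lambda>(r, _). x $ r) \<in> carrier_mat m 1" by simp
  from kron_carrier[OF one_carrier_mat this] show ?thesis by (simp add: flag_op_def)
qed

text \<open>By the mixed-product rule the identity factors give an identity and the two flag columns
  a 1 by 1 matrix. Hence unit flags are isometries, and orthogonal flags have orthogonal
  ranges.\<close>

lemma flag_op_inner:
  assumes x: "x \<in> carrier_vec m" and y: "y \<in> carrier_vec m"
  shows "mat_adjoint (flag_op d m x) * flag_op d m y = (conjugate x \<bullet> y) \<cdot>\<^sub>m 1\<^sub>m d"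
proof -
  define X where "X = mat m 1 (\<lambda>(r, _). x $ r)"
  define Y where "Y = mat m 1 (\<lambda>(r, _). y $ r)"
  have X: "X \<in> carrier_mat m 1" and Y: "Y \<in> carrier_mat m 1" by (auto simp: X_def Y_def)
  have "mat_adjoint X * Y = (conjugate x \<bullet> y) \<cdot>\<^sub>m 1\<^sub>m 1"
  proof (rule eq_matI)
    fix i j assume "i < dim_row ((conjugate x \<bullet> y) \<cdot>\<^sub>m 1\<^sub>m 1)" "j < dim_col ((conjugate x \<bullet> y) \<cdot>\<^sub>m 1\<^sub>m 1)"
    then have ij: "i < 1" "j < 1" by auto
    show "(mat_adjoint X * Y) $$ (i, j) = ((conjugate x \<bullet> y) \<cdot>\<^sub>m 1\<^sub>m 1) $$ (i, j)"
      unfolding mat_mult_index[OF mat_adjoint_carrier[OF X] Y ij]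
      using ij x y by (auto simp: X_def Y_def scalar_prod_def atLeast0LessThan intro!: sum.cong)
  qed (use X Y in auto)
  then show ?thesis
    unfolding flag_op_def X_def[symmetric] Y_def[symmetric] kron_adjoint
    by (subst kron_mult[OF mat_adjoint_carrier[OF one_carrier_mat] mat_adjoint_carrier[OF X] one_carrier_mat Y])
      (simp del: One_nat_def add: kron_smult_right)
qed

lemma flag_op_isometry:
  assumes "x \<in> carrier_vec m" "conjugate x \<bullet> x = 1"
  shows "mat_adjoint (flag_op d m x) * flag_op d m x = 1\<^sub>m d"
  using assms by (auto simp: flag_op_inner intro: eq_matI)

lemma flag_op_orthogonal:
  assumes "x \<in> carrier_vec m" "y \<in> carrier_vec m" "conjugate x \<bullet> y = 0"
  shows "mat_adjoint (flag_op d m x) * flag_op d m y = 0\<^sub>m d d"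
  using assms by (auto simp: flag_op_inner intro: eq_matI)

lemma unit_vec_inner:
  assumes "i < m" "j < m"
  shows "conjugate (unit_vec m i) \<bullet> (unit_vec m j :: complex vec) = (if i = j then 1 else 0)"
  using assms by (simp add: scalar_prod_right_unit[OF assms(2)])

lemma flag_iso_carrier:
  "k < length ds \<Longrightarrow> flag_iso ds k m x \<in> carrier_mat (tdim (ds[k := ds ! k * m])) (tdim ds)"
  by (simp add: flag_iso_loc)

lemma flag_iso_isometry:
  assumes "k < length ds" "x \<in> carrier_vec m" "conjugate x \<bullet> x = 1"
  shows "mat_adjoint (flag_iso ds k m x) * flag_iso ds k m x = 1\<^sub>m (tdim ds)"
  using loc_isometry[OF assms(1) flag_op_carrier flag_op_isometry[OF assms(2,3)]]
  by (simp add: flag_iso_loc)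

text \<open>The probabilities of [FLAGS] are absorbed into the traces of the \<open>A i\<close>.
  Flag isometries preserve the trace, so the flagged mixture is again T times a state.\<close>

lemma homog_FLAGS:
  fixes n :: nat
  assumes FLAGS: "FLAGS N f" and len: "length ds = N" and k: "k < N"
    and psd: "\<And>i. i < n \<Longrightarrow> psd (tdim ds) (A i)"
    and x: "\<And>i. i < n \<Longrightarrow> x i \<in> carrier_vec m"
    and orth: "\<And>i j. i < n \<Longrightarrow> j < n \<Longrightarrow> conjugate (x i) \<bullet> x j = (if i = j then 1 else 0)"
  defines "D \<equiv> tdim (ds[k := ds ! k * m])"
  shows "homog f (ds[k := ds ! k * m]) (rsum D D (\<lambda>i. sand (flag_iso ds k m (x i)) (A i)) {..<n})
    = (\<Sum>i<n. homog f ds (A i))"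
proof -
  have kl: "k < length ds" using k len by simp
  define F where "F i = flag_iso ds k m (x i)" for i
  have F: "F i \<in> carrier_mat D (tdim ds)" for i using flag_iso_carrier[OF kl] by (simp add: F_def D_def)
  have iso: "mat_adjoint (F i) * F i = 1\<^sub>m (tdim ds)" if "i < n" for i
    unfolding F_def using x[OF that] orth[OF that that] by (intro flag_iso_isometry kl) auto
  define T where "T = (\<Sum>i<n. Re (mtrace (A i)))"
  have tr: "0 \<le> Re (mtrace (A i))" if "i < n" for i using psd_trace(2)[OF psd[OF that]] .
  show ?thesis
  proof (cases "T = 0")
    case True
    then have "\<forall>i\<in>{..<n}. Re (mtrace (A i)) = 0"
      unfolding T_def using sum_nonneg_eq_0_iff[of "{..<n}" "\<lambda>i. Re (mtrace (A i))"] tr by simp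
    then have 0: "A i = 0\<^sub>m (tdim ds) (tdim ds)" if "i < n" for i
      using psd_trace_zero[OF psd] that by blast
    have "rsum D D (\<lambda>i. sand (F i) (A i)) {..<n} = 0\<^sub>m D D"
      using F by (intro rsum_zero) (auto simp: 0)
    then show ?thesis by (simp add: 0 F_def)
  next
    case False
    then have pos: "0 < T" using tr by (auto simp: T_def less_le intro!: sum_nonneg)
    obtain \<rho> p where d: "\<And>i. i < n \<Longrightarrow> density (tdim ds) (\<rho> i)" "\<And>i. i < n \<Longrightarrow> 0 \<le> p i" "(\<Sum>i<n. p i) = 1"
      and A: "\<And>i. i < n \<Longrightarrow> A i = complex_of_real T \<cdot>\<^sub>m (complex_of_real (p i) \<cdot>\<^sub>m \<rho> i)"
      and h: "\<And>i f ds. i < n \<Longrightarrow> homog f ds (A i) = T * (p i * f ds (\<rho> i))"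
      by (rule psd_mixture[of n "tdim ds" A, OF _ T_def pos]) (use psd in blast, rule that)
    have c: "\<rho> i \<in> carrier_mat (tdim ds) (tdim ds)" if "i < n" for i
      using d(1)[OF that] by (auto simp: density_def)
    let ?M = "rsum D D (\<lambda>i. complex_of_real (p i) \<cdot>\<^sub>m sand (F i) (\<rho> i)) {..<n}"
    have "rsum D D (\<lambda>i. sand (F i) (A i)) {..<n} = complex_of_real T \<cdot>\<^sub>m ?M"
      by (subst smult_rsum)
        (auto simp: A sand_smult[OF F c] sand_smult[OF F smult_carrier_mat[OF c]] sand_carrier[OF F] intro!: rsum_cong)
    then have "homog f (ds[k := ds ! k * m]) (rsum D D (\<lambda>i. sand (F i) (A i)) {..<n})
        = T * homog f (ds[k := ds ! k * m]) ?M"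
      using pos by (simp add: homog_smult[OF rsum_carrier])
    also have "mtrace ?M = 1"
    proof -
      have "mtrace ?M = (\<Sum>i<n. mtrace (complex_of_real (p i) \<cdot>\<^sub>m sand (F i) (\<rho> i)))"
        by (intro mtrace_rsum) (simp add: sand_carrier[OF F])
      also have "\<dots> = (\<Sum>i<n. complex_of_real (p i) * mtrace (\<rho> i))"
        by (intro sum.cong) (simp_all add: mtrace_smult[OF sand_carrier[OF F]] mtrace_sand_isometry[OF F c iso])
      also have "\<dots> = 1" using d(1,3) by (simp add: density_def flip: of_real_sum)
      finally show ?thesis .
    qed
    then have "T * homog f (ds[k := ds ! k * m]) ?M = T * f (ds[k := ds ! k * m]) ?M"
      by (simp add: homog_trace_one)
    also have "f (ds[k := ds ! k * m]) ?M = (\<Sum>i<n. p i * f ds (\<rho> i))"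
    proof -
      have "\<forall>i<n. mstate ds (\<rho> i) \<and> 0 \<le> p i \<and> x i \<in> carrier_vec m" using d x by (simp add: mstate_def)
      then show ?thesis
        using FLAGS[unfolded FLAGS_def msum_rsum, rule_format, of ds k n \<rho> p x m] len k d(3) orth
        unfolding D_def F_def sand_def by blast
    qed
    also have "T * (\<Sum>i<n. p i * f ds (\<rho> i)) = (\<Sum>i<n. homog f ds (A i))"
      by (simp add: h sum_distrib_left)
    finally show ?thesis by (simp add: F_def)
  qed
qed

text \<open>[FLAGS] for a family with one member: a local ancilla in a pure state does not change
  \<open>f\<close>. This is the way to enlarge a local dimension.\<close>

lemma homog_flag:
  assumes "FLAGS N f" "length ds = N" "k < N" "psd (tdim ds) A"
    and "x \<in> carrier_vec m" "conjugate x \<bullet> x = 1"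
  shows "homog f (ds[k := ds ! k * m]) (sand (flag_iso ds k m x) A) = homog f ds A"
proof -
  have "k < length ds" using assms by simp
  note c = sand_carrier[OF flag_iso_carrier[OF this], of m x A]
  from homog_FLAGS[OF assms(1-3), of 1 "\<lambda>_. A" "\<lambda>_. x" m] assms(4-)
  show ?thesis by (simp add: left_add_zero_mat[OF c] rsum_lessThan_Suc[of "\<lambda>_. sand (flag_iso ds k m x) A" 0, OF c])
qed

lemma homog_local_unitary:
  assumes LUI: "LUI N f" and len: "length ds = N" and k: "k < N"
    and U: "unitary_mat (ds ! k) U" and psd: "psd (tdim ds) A"
  shows "homog f ds (sand (loc ds k U) A) = homog f ds A"
proof -
  have kl: "k < length ds" using k len by simp
  have Uc: "U \<in> carrier_mat (ds ! k) (ds ! k)" and iso: "mat_adjoint U * U = 1\<^sub>m (ds ! k)"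
    using U by (auto simp: unitary_mat_def)
  have L: "loc ds k U \<in> carrier_mat (tdim ds) (tdim ds)" using loc_carrier[OF kl Uc] by simp
  have A: "A \<in> carrier_mat (tdim ds) (tdim ds)" using psd by simp
  have tr: "mtrace (sand (loc ds k U) A) = mtrace A"
    using loc_isometry[OF kl Uc iso] by (intro mtrace_sand_isometry[OF L A]) simp
  show ?thesis
  \<comment> \<open>[LUI] concerns states only, so it is applied to the normalised matrix; at trace
    0 both sides carry the factor 0.\<close>
  proof (cases "Re (mtrace A) = 0")
    case False
    then have pos: "0 < Re (mtrace A)" using psd_trace(2)[OF psd] by simp
    define Us where "Us = map 1\<^sub>m (take k ds) @ U # map 1\<^sub>m (drop (Suc k) ds)"
    have "length Us = N" using len kl by (simp add: Us_def)
    moreover have "unitary_mat (ds ! i) (Us ! i)" if "i < N" for i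
      using that len U by (auto simp: Us_def nth_append unitary_mat_def nth_Cons' not_less)
    moreover have "mstate ds (complex_of_real (1 / Re (mtrace A)) \<cdot>\<^sub>m A)"
      unfolding mstate_def by (rule density_normalized[OF psd pos])
    ultimately have "f ds (sand (kron_list Us) (complex_of_real (1 / Re (mtrace A)) \<cdot>\<^sub>m A))
        = f ds (complex_of_real (1 / Re (mtrace A)) \<cdot>\<^sub>m A)"
      using LUI len unfolding LUI_def sand_def by blast
    then show ?thesis
      by (simp add: Us_def kron_list_loc homog_def tr sand_smult[OF L A])
  qed (simp add: homog_def tr)
qed

section \<open>Isometries on one party\<close>

text \<open>\<open>U\<close> is the reflection exchanging \<open>E\<close> and \<open>W\<close>.\<close>

lemma unitary_mapping_orthogonal_isometries:
  assumes E: "E \<in> carrier_mat D d" and W: "W \<in> carrier_mat D d"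
    and EE: "mat_adjoint E * E = 1\<^sub>m d" and WW: "mat_adjoint W * W = 1\<^sub>m d"
    and EW: "mat_adjoint E * W = 0\<^sub>m d d"
  obtains U where "unitary_mat D U" "U * E = W"
proof -
  define S where "S = W - E"
  have S: "S \<in> carrier_mat D d" unfolding S_def by (rule minus_carrier_mat[OF E])
  have S': "mat_adjoint S \<in> carrier_mat d D" and E': "mat_adjoint E \<in> carrier_mat d D"
    and W': "mat_adjoint W \<in> carrier_mat d D" using S E W by auto
  have WE: "mat_adjoint W * E = 0\<^sub>m d d"
    using mat_adjoint_mult[OF E' W] EW by simp
  have S'_eq: "mat_adjoint S = mat_adjoint W - mat_adjoint E"
    unfolding S_def by (rule mat_adjoint_minus[OF W E])
  have SE: "mat_adjoint S * E = - 1\<^sub>m d"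
    unfolding S'_eq minus_mult_distrib_mat[OF W' E' E] EE WE by (intro eq_matI) auto
  have "mat_adjoint S * W = 1\<^sub>m d"
    unfolding S'_eq minus_mult_distrib_mat[OF W' E' W] EW WW by (intro eq_matI) auto
  then have SS: "mat_adjoint S * S = 2 \<cdot>\<^sub>m 1\<^sub>m d"
    by (subst (2) S_def, subst mult_minus_distrib_mat[OF S' W E]) (auto simp: SE intro!: eq_matI)
  \<comment> \<open>A Householder reflection \<open>1 - 2 P\<close> without a visible factor 2:
    since \<open>mat_adjoint S * S\<close> is twice the identity, \<open>S * mat_adjoint S\<close>
    is already twice the projection onto the range of S. As \<open>mat_adjoint S * E\<close> is
    minus the identity, U sends E to \<open>E + S = W\<close>.\<close>
  define U where "U = 1\<^sub>m D - S * mat_adjoint S"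
  have P: "S * mat_adjoint S \<in> carrier_mat D D" using S S' by simp
  have U: "U \<in> carrier_mat D D" unfolding U_def by (rule minus_carrier_mat[OF P])
  have PP: "S * mat_adjoint S * (S * mat_adjoint S) = 2 \<cdot>\<^sub>m (S * mat_adjoint S)"
  proof -
    have "S * mat_adjoint S * (S * mat_adjoint S) = S * (mat_adjoint S * (S * mat_adjoint S))"
      using S S' P by (intro assoc_mult_mat)
    also have "mat_adjoint S * (S * mat_adjoint S) = mat_adjoint S * S * mat_adjoint S"
      using S S' by (intro assoc_mult_mat[symmetric])
    also have "\<dots> = 2 \<cdot>\<^sub>m mat_adjoint S"
      unfolding SS using left_mult_one_mat[OF S'] by (simp add: mult_smult_assoc_mat[OF one_carrier_mat S'])
    finally show ?thesis using mult_smult_distrib[OF S S'] by simp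
  qed
  have UU: "U * U = 1\<^sub>m D"
    unfolding U_def minus_mult_distrib_mat[OF one_carrier_mat P minus_carrier_mat[OF P]]
      mult_minus_distrib_mat[OF P one_carrier_mat P] PP
    using P by (auto intro!: eq_matI)
  have "mat_adjoint U = U"
    unfolding U_def mat_adjoint_minus[OF one_carrier_mat P] mat_adjoint_mult[OF S S'] by simp
  with U UU have "unitary_mat D U" by (simp add: unitary_mat_def)
  moreover have "U * E = W"
  proof -
    have "S * mat_adjoint S * E = S * (mat_adjoint S * E)" using S S' E by (intro assoc_mult_mat)
    also have "\<dots> = - S" unfolding SE using S by simp
    finally have "U * E = E - (- S)"
      unfolding U_def minus_mult_distrib_mat[OF one_carrier_mat P E] using E by simp
    also have "\<dots> = W" unfolding S_def using E W by (intro eq_matI) auto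
    finally show ?thesis .
  qed
  ultimately show ?thesis by (rule that)
qed

text \<open>The reflection acts on party k of the enlarged system, where [LUI] applies, and turns
  the embedding E into W.\<close>

lemma homog_isometry:
  assumes LUI: "LUI N f" and len: "length ds = N" and k: "k < N" and psd: "psd (tdim ds) A"
    and E: "E \<in> carrier_mat D (ds ! k)" and W: "W \<in> carrier_mat D (ds ! k)"
    and EE: "mat_adjoint E * E = 1\<^sub>m (ds ! k)" and WW: "mat_adjoint W * W = 1\<^sub>m (ds ! k)"
    and EW: "mat_adjoint E * W = 0\<^sub>m (ds ! k) (ds ! k)"
  shows "homog f (ds[k := D]) (sand (loc ds k W) A) = homog f (ds[k := D]) (sand (loc ds k E) A)"
proof -
  have kl: "k < length ds" using k len by simp
  obtain U where U: "unitary_mat D U" and UE: "U * E = W"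
    using unitary_mapping_orthogonal_isometries[OF E W EE WW EW] .
  have Uc: "U \<in> carrier_mat D D" using U by (simp add: unitary_mat_def)
  have "psd (tdim (ds[k := D])) (sand (loc ds k E) A)"
    using kl E by (intro psd_sand[OF psd]) simp
  then have "homog f (ds[k := D]) (sand (loc (ds[k := D]) k U) (sand (loc ds k E) A))
      = homog f (ds[k := D]) (sand (loc ds k E) A)"
    using kl U len k by (intro homog_local_unitary[OF LUI]) auto
  also have "sand (loc (ds[k := D]) k U) (sand (loc ds k E) A) = sand (loc ds k (U * E)) A"
    using sand_loc_mult[OF kl Uc E] psd by simp
  finally show ?thesis by (simp add: UE)
qed

section \<open>Averaging over phases\<close>

text \<open>Orthogonality of the characters of the cyclic group of order n. For distinct i and j the
  number z is an n-th root of unity; it is not 1 because the difference of i and j is nonzero and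
  smaller than n in absolute value. The geometric sum therefore vanishes.\<close>

lemma sum_phases:
  assumes "i < n" "j < n"
  shows "(\<Sum>a<n. cis (2 * pi * real a * real i / real n) * cnj (cis (2 * pi * real a * real j / real n)))
     = (if i = j then of_nat n else 0)"
proof -
  define z where "z = cis (2 * pi * (real i - real j) / real n)"
  have "cis (2 * pi * real a * real i / real n) * cnj (cis (2 * pi * real a * real j / real n)) = z ^ a" for a
    by (simp add: z_def cis_cnj cis_mult DeMoivre diff_divide_distrib algebra_simps)
  then have s: "(\<Sum>a<n. cis (2 * pi * real a * real i / real n) * cnj (cis (2 * pi * real a * real j / real n)))
      = (\<Sum>a<n. z ^ a)" by simp
  show ?thesis
  proof (cases "i = j")
    case True
    then show ?thesis unfolding s by (simp add: z_def)
  next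
    case False
    have n: "0 < n" using assms by simp
    have "z ^ n = cis (2 * pi * (real i - real j))" using n by (simp add: z_def DeMoivre)
    also have "\<dots> = cis (2 * pi * real_of_int (int i - int j))" by simp
    also have "\<dots> = 1" by (rule cis_multiple_2pi) simp
    finally have zn: "z ^ n = 1" .
    have "z \<noteq> 1"
    proof
      assume "z = 1"
      then have "cos (2 * pi * (real i - real j) / real n) = 1" by (simp add: z_def complex_eq_iff)
      then obtain l :: int where "2 * pi * (real i - real j) / real n = of_int l * 2 * pi"
        using cos_one_2pi_int by blast
      then have "(2 * pi) * ((real i - real j) / real n) = (2 * pi) * of_int l" by (simp add: mult_ac)
      then have "(real i - real j) / real n = of_int l" by (subst (asm) mult_cancel_left) simp
      then have "real i - real j = of_int l * real n" using n by (simp add: field_simps)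
      then have l: "int i - int j = l * int n" by (metis of_int_diff of_int_eq_iff of_int_mult of_int_of_nat_eq)
      then have "\<bar>l\<bar> * int n = \<bar>int i - int j\<bar>" by (simp add: abs_mult)
      also have "\<dots> < 1 * int n" using assms by simp
      finally have "\<bar>l\<bar> * int n < 1 * int n" .
      then have "l = 0" using n by (simp add: mult_less_cancel_right)
      then show False using l False by simp
    qed
    then show ?thesis unfolding s using False zn by (simp add: geometric_sum)
  qed
qed

text \<open>Conjugation by a linear combination expands into a double sum whose (i, j) term carries
  \<open>c a i * cnj (c a j)\<close>. The sum over a kills the terms with distinct i and j, and
  gives a factor n on the diagonal that cancels the weight \<open>1 / n\<close>.\<close>

lemma sand_phase_average:
  fixes c :: "nat \<Rightarrow> nat \<Rightarrow> complex"
  assumes H: "\<And>j. j < n \<Longrightarrow> H j \<in> carrier_mat r m" and A: "A \<in> carrier_mat m m" and n: "0 < n"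
    and c: "\<And>i j. i < n \<Longrightarrow> j < n \<Longrightarrow> (\<Sum>a<n. c a i * cnj (c a j)) = (if i = j then of_nat n else 0)"
  shows "rsum r r (\<lambda>a. complex_of_real (1 / real n) \<cdot>\<^sub>m sand (rsum r m (\<lambda>j. c a j \<cdot>\<^sub>m H j) {..<n}) A) {..<n}
    = rsum r r (\<lambda>j. sand (H j) A) {..<n}" (is "?L = ?R")
proof (rule eq_matI)
  fix p q assume "p < dim_row ?R" "q < dim_col ?R"
  then have pq: "p < r" "q < r" by auto
  define X where "X i j = (H i * A * mat_adjoint (H j)) $$ (p, q)" for i j
  have HA: "H i * A \<in> carrier_mat r m" if "i < n" for i using H[OF that] A by simp
  have HH: "H i * A * mat_adjoint (H j) \<in> carrier_mat r r" if "i < n" "j < n" for i j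
    using HA[OF that(1)] H[OF that(2)] by simp
  have s: "sand (rsum r m (\<lambda>j. c a j \<cdot>\<^sub>m H j) {..<n}) A $$ (p, q)
      = (\<Sum>i<n. \<Sum>j<n. c a i * cnj (c a j) * X i j)" (is "sand ?W A $$ _ = _") for a
  proof -
    have W': "mat_adjoint ?W = rsum m r (\<lambda>j. cnj (c a j) \<cdot>\<^sub>m mat_adjoint (H j)) {..<n}"
      using H by (subst mat_adjoint_rsum) (auto intro!: rsum_cong eq_matI)
    have "?W * A = rsum r m (\<lambda>i. c a i \<cdot>\<^sub>m (H i * A)) {..<n}"
      using H A by (subst rsum_mult[OF A]) (auto intro!: rsum_cong mult_smult_assoc_mat)
    then have "sand ?W A = rsum r r (\<lambda>i. c a i \<cdot>\<^sub>m (H i * A) * mat_adjoint ?W) {..<n}"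
      unfolding sand_def using HA
      by (simp only:) (rule rsum_mult, auto)
    then have "sand ?W A $$ (p, q) = (\<Sum>i<n. (c a i \<cdot>\<^sub>m (H i * A) * mat_adjoint ?W) $$ (p, q))"
      using pq by simp
    also have "\<dots> = (\<Sum>i<n. \<Sum>j<n. c a i * cnj (c a j) * X i j)"
    proof (rule sum.cong)
      fix i assume "i \<in> {..<n}"
      then have i: "i < n" by simp
      have "c a i \<cdot>\<^sub>m (H i * A) * mat_adjoint ?W =
          rsum r r (\<lambda>j. c a i \<cdot>\<^sub>m (H i * A) * (cnj (c a j) \<cdot>\<^sub>m mat_adjoint (H j))) {..<n}"
        unfolding W' using HA[OF i] H by (intro mult_rsum[of _ r m]) auto
      also have "\<dots> = rsum r r (\<lambda>j. (c a i * cnj (c a j)) \<cdot>\<^sub>m (H i * A * mat_adjoint (H j))) {..<n}"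
      proof (rule rsum_cong)
        fix j assume "j \<in> {..<n}"
        then have "mat_adjoint (H j) \<in> carrier_mat m r" using H by auto
        then show "c a i \<cdot>\<^sub>m (H i * A) * (cnj (c a j) \<cdot>\<^sub>m mat_adjoint (H j))
            = (c a i * cnj (c a j)) \<cdot>\<^sub>m (H i * A * mat_adjoint (H j))"
          using HA[OF i] by (subst mult_smult_distrib[of _ r m _ r], simp, simp,
            subst mult_smult_assoc_mat[of _ r m _ r]) (auto simp: mult.commute)
      qed simp
      finally show "(c a i \<cdot>\<^sub>m (H i * A) * mat_adjoint ?W) $$ (p, q) = (\<Sum>j<n. c a i * cnj (c a j) * X i j)"
        using pq by (auto simp: X_def i carrier_matD[OF H] intro!: sum.cong)
    qed simp
    finally show ?thesis .
  qed
  have "?L $$ (p, q) = (\<Sum>a<n. complex_of_real (1 / real n) * (\<Sum>i<n. \<Sum>j<n. c a i * cnj (c a j) * X i j))"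
    using pq by (simp add: s carrier_matD[OF sand_carrier[OF rsum_carrier]])
  also have "\<dots> = (\<Sum>a<n. \<Sum>i<n. \<Sum>j<n. complex_of_real (1 / real n) * X i j * (c a i * cnj (c a j)))"
    by (simp add: sum_distrib_left mult_ac)
  also have "\<dots> = (\<Sum>i<n. \<Sum>a<n. \<Sum>j<n. complex_of_real (1 / real n) * X i j * (c a i * cnj (c a j)))"
    by (rule sum.swap)
  also have "\<dots> = (\<Sum>i<n. \<Sum>j<n. \<Sum>a<n. complex_of_real (1 / real n) * X i j * (c a i * cnj (c a j)))"
    by (intro sum.cong refl sum.swap)
  also have "\<dots> = (\<Sum>i<n. \<Sum>j<n. complex_of_real (1 / real n) * X i j * (\<Sum>a<n. c a i * cnj (c a j)))"
    by (simp only: sum_distrib_left)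
  also have "\<dots> = (\<Sum>i<n. \<Sum>j<n. if i = j then X i j else 0)"
    using n by (intro sum.cong refl) (simp add: c)
  also have "\<dots> = ?R $$ (p, q)"
    using pq by (simp add: X_def sand_def)
  finally show "?L $$ (p, q) = ?R $$ (p, q)" .
qed auto

section \<open>Local instruments\<close>

text \<open>Makes outputs of different dimensions comparable: if e divides D, adjoining an ancilla
  of dimension \<open>D / e\<close> in a fixed pure state embeds the smaller space without changing
  \<open>f\<close>.\<close>

lemma flag_embedding:
  assumes FLAGS: "FLAGS N f" and len: "length ds = N" and k: "k < N"
    and dvd: "e \<noteq> 0 \<Longrightarrow> e dvd D" and D: "D \<noteq> 0"
  obtains V where "V \<in> carrier_mat D e" "mat_adjoint V * V = 1\<^sub>m e"
    "\<And>B. psd (tdim (ds[k := e])) B \<Longrightarrow>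
       homog f (ds[k := D]) (sand (loc ds k V) B) = homog f (ds[k := e]) B"
proof (cases "e = 0")
  case True
  have kl: "k < length ds" using k len by simp
  show ?thesis
  \<comment> \<open>For e = 0 the global space is trivial. A matrix without columns is vacuously an
    isometry, and \<open>homog\<close> vanishes on both sides.\<close>
  proof (rule that[of "0\<^sub>m D e"])
    show "mat_adjoint (0\<^sub>m D e) * 0\<^sub>m D e = (1\<^sub>m e :: complex mat)" using True by (intro eq_matI) auto
    fix B assume "psd (tdim (ds[k := e])) B"
    moreover have "tdim (ds[k := e]) = 0" using kl True by (simp add: tdim_update)
    ultimately have B: "B \<in> carrier_mat 0 0" by simp
    then have B0: "B = 0\<^sub>m 0 0" by (intro eq_matI) auto
    have "loc ds k (0\<^sub>m D e) \<in> carrier_mat (tdim (ds[k := D])) 0"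
      using loc_carrier[OF kl zero_carrier_mat, of D e] \<open>tdim (ds[k := e]) = 0\<close> by simp
    then show "homog f (ds[k := D]) (sand (loc ds k (0\<^sub>m D e)) B) = homog f (ds[k := e]) B"
      unfolding B0 by (subst sand_zero) auto
  qed simp
next
  case False
  then obtain m where m: "D = e * m" using dvd by (auto simp: dvd_def)
  then have "0 < m" using D by (cases m) auto
  then have inner: "conjugate (unit_vec m 0) \<bullet> (unit_vec m 0 :: complex vec) = 1"
    using unit_vec_inner[of 0 m 0] by simp
  show ?thesis
  proof (rule that[of "flag_op e m (unit_vec m 0)"])
    show "flag_op e m (unit_vec m 0) \<in> carrier_mat D e" unfolding m by simp
    show "mat_adjoint (flag_op e m (unit_vec m 0)) * flag_op e m (unit_vec m 0) = 1\<^sub>m e"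
      by (rule flag_op_isometry[OF _ inner]) simp
    fix B assume B: "psd (tdim (ds[k := e])) B"
    have "k < length ds" using k len by simp
    then show "homog f (ds[k := D]) (sand (loc ds k (flag_op e m (unit_vec m 0))) B) = homog f (ds[k := e]) B"
      using homog_flag[OF FLAGS _ k B _ inner] len by (simp add: flag_iso_loc m)
  qed
qed

text \<open>The heart of sufficiency: a complete local measurement with one Kraus operator per
  outcome, where each outcome has its own output dimension.\<close>

lemma homog_kraus:
  fixes n :: nat
  assumes conv: "convex_fun N f" and LUI: "LUI N f" and FLAGS: "FLAGS N f"
    and len: "length ds = N" and k: "k < N"
    and K: "\<And>i. i < n \<Longrightarrow> K i \<in> carrier_mat (e i) (ds ! k)"
    and complete: "rsum (ds ! k) (ds ! k) (\<lambda>i. mat_adjoint (K i) * K i) {..<n} = 1\<^sub>m (ds ! k)"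
    and psd: "psd (tdim ds) A"
  shows "(\<Sum>i<n. homog f (ds[k := e i]) (sand (loc ds k (K i)) A)) \<le> homog f ds A"
\<comment> \<open>A zero-dimensional party makes all terms vanish. Otherwise completeness excludes n
  = 0, which the average over n phases requires.\<close>
proof (cases "ds ! k = 0")
  case True
  have kl: "k < length ds" using k len by simp
  have t0: "tdim ds = 0" using True kl by (simp add: tdim_split[OF kl])
  have A0: "A = 0\<^sub>m (tdim ds) (tdim ds)" using psd_carrier[OF psd] unfolding t0 by (intro eq_matI) auto
  have "sand (loc ds k (K i)) A = 0\<^sub>m (tdim (ds[k := e i])) (tdim (ds[k := e i]))" if "i < n" for i
    by (subst A0) (rule sand_zero[OF loc_carrier'[OF kl K[OF that]]])
  moreover have "homog f ds A = 0" by (subst A0) simp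
  ultimately show ?thesis by simp
next
  case False
  have kl: "k < length ds" using k len by simp
  define d where "d = ds ! k"
  note K = K[folded d_def] and complete = complete[folded d_def]
  have d: "d \<noteq> 0" using False by (simp add: d_def)
  have n: "0 < n"
  proof (rule ccontr)
    assume "\<not> 0 < n"
    then have "0\<^sub>m d d = (1\<^sub>m d :: complex mat)" using complete by simp
    then have "(0\<^sub>m d d :: complex mat) $$ (0, 0) = 1\<^sub>m d $$ (0, 0)" by simp
    then show False using d by simp
  qed
  \<comment> \<open>Output dimensions 0 are replaced by 1 to keep the product positive. Then
    \<open>D = d * M\<close> is a nonzero multiple of d and of each nonzero
    \<open>e i\<close>.\<close>
  define M where "M = (\<Prod>i<n. if e i = 0 then 1 else e i)"
  define D where "D = d * M"
  have M: "0 < M" by (simp add: M_def prod_pos)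
  have D: "D \<noteq> 0" using M d by (simp add: D_def)
  have dvd: "e i dvd D" if "i < n" "e i \<noteq> 0" for i
  proof -
    have "(if e i = 0 then 1 else e i) dvd M" unfolding M_def using that by (intro dvd_prodI) auto
    then show ?thesis using that by (simp add: D_def)
  qed
  have "\<exists>V. V \<in> carrier_mat D (e i) \<and> mat_adjoint V * V = 1\<^sub>m (e i) \<and>
      (\<forall>B. psd (tdim (ds[k := e i])) B \<longrightarrow>
        homog f (ds[k := D]) (sand (loc ds k V) B) = homog f (ds[k := e i]) B)" if "i < n" for i
    using flag_embedding[OF FLAGS len k dvd[OF that] D] by metis
  then obtain V where V: "\<And>i. i < n \<Longrightarrow> V i \<in> carrier_mat D (e i)"
    and VV: "\<And>i. i < n \<Longrightarrow> mat_adjoint (V i) * V i = 1\<^sub>m (e i)"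
    and Vh: "\<And>i B. i < n \<Longrightarrow> psd (tdim (ds[k := e i])) B \<Longrightarrow>
        homog f (ds[k := D]) (sand (loc ds k (V i)) B) = homog f (ds[k := e i]) B"
    by metis
  \<comment> \<open>There are \<open>Suc n\<close> flags: flag 0 marks the input and flag
    \<open>Suc i\<close> the output of the i-th Kraus operator.\<close>
  define x where "x i = (unit_vec (Suc n) i :: complex vec)" for i
  have xc: "x i \<in> carrier_vec (Suc n)" for i by (simp add: x_def)
  have xx: "conjugate (x i) \<bullet> x j = (if i = j then 1 else 0)" if "i \<le> n" "j \<le> n" for i j
    unfolding x_def using that by (intro unit_vec_inner) auto
  define X where "X i = flag_op D (Suc n) (x i)" for i
  define D2 where "D2 = D * Suc n"
  have X: "X i \<in> carrier_mat D2 D" for i by (simp add: X_def D2_def del: mult_Suc_right)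
  have XX: "mat_adjoint (X i) * X j = (if i = j then 1\<^sub>m D else 0\<^sub>m D D)" if "i \<le> n" "j \<le> n" for i j
    unfolding X_def using xx[OF that] xx[OF that(1) that(1)]
    by (auto simp: flag_op_isometry[OF xc] flag_op_orthogonal[OF xc xc])
  \<comment> \<open>An ancilla of dimension M raises the input from dimension d to D, so that it
    lies in the same space as the embedded outputs \<open>L i\<close>.\<close>
  define y where "y = (unit_vec M 0 :: complex vec)"
  have y: "y \<in> carrier_vec M" "conjugate y \<bullet> y = 1"
    using unit_vec_inner[of 0 M 0] M by (simp_all add: y_def)
  define F where "F = flag_op d M y"
  have F: "F \<in> carrier_mat D d" by (simp add: F_def D_def)
  have FF: "mat_adjoint F * F = 1\<^sub>m d" unfolding F_def by (rule flag_op_isometry[OF y])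
  define L where "L i = V i * K i" for i
  have L: "L i \<in> carrier_mat D d" if "i < n" for i
    unfolding L_def by (rule mult_carrier_mat[OF V[OF that] K[OF that]])
  have LL: "mat_adjoint (L i) * L i = mat_adjoint (K i) * K i" if "i < n" for i
  proof -
    note Vi = V[OF that] and Ki = K[OF that]
    note V' = mat_adjoint_carrier[OF Vi] and K' = mat_adjoint_carrier[OF Ki]
    have "mat_adjoint (L i) * L i = mat_adjoint (K i) * mat_adjoint (V i) * (V i * K i)"
      unfolding L_def mat_adjoint_mult[OF Vi Ki] ..
    also have "\<dots> = mat_adjoint (K i) * (mat_adjoint (V i) * (V i * K i))"
      by (rule assoc_mult_mat[OF K' V' mult_carrier_mat[OF Vi Ki]])
    also have "mat_adjoint (V i) * (V i * K i) = mat_adjoint (V i) * V i * K i"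
      by (rule assoc_mult_mat[OF V' Vi Ki, symmetric])
    finally show ?thesis using Ki by (simp add: VV[OF that])
  qed
  \<comment> \<open>All inner products needed for E and the \<open>G i\<close> are instances of
    this: different flags give 0, equal flags disappear.\<close>
  have XLXL: "mat_adjoint (X i * P) * (X j * Q) = (if i = j then mat_adjoint P * Q else 0\<^sub>m d d)"
    if "i \<le> n" "j \<le> n" and P: "P \<in> carrier_mat D d" and Q: "Q \<in> carrier_mat D d" for i j P Q
  proof -
    note P' = mat_adjoint_carrier[OF P] and X' = mat_adjoint_carrier[OF X]
    have "mat_adjoint (X i * P) * (X j * Q) = mat_adjoint P * mat_adjoint (X i) * (X j * Q)"
      unfolding mat_adjoint_mult[OF X P] ..
    also have "\<dots> = mat_adjoint P * (mat_adjoint (X i) * (X j * Q))"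
      by (rule assoc_mult_mat[OF P' X' mult_carrier_mat[OF X Q]])
    also have "mat_adjoint (X i) * (X j * Q) = mat_adjoint (X i) * X j * Q"
      by (rule assoc_mult_mat[OF X' X Q, symmetric])
    finally show ?thesis using Q P'
      by (auto simp: XX[OF that(1,2)] left_mult_zero_mat[OF Q] right_mult_zero_mat[OF P'])
  qed
  define E where "E = X 0 * F"
  have E: "E \<in> carrier_mat D2 d" unfolding E_def by (rule mult_carrier_mat[OF X F])
  have EE: "mat_adjoint E * E = 1\<^sub>m d" unfolding E_def using XLXL[OF _ _ F F, of 0 0] FF by simp
  define G where "G i = X (Suc i) * L i" for i
  have G: "G i \<in> carrier_mat D2 d" if "i < n" for i unfolding G_def by (rule mult_carrier_mat[OF X L[OF that]])
  have GG: "mat_adjoint (G i) * G j = (if i = j then mat_adjoint (K i) * K i else 0\<^sub>m d d)"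
    if "i < n" "j < n" for i j
    unfolding G_def using XLXL[OF _ _ L[OF that(1)] L[OF that(2)], of "Suc i" "Suc j"] that LL[OF that(1)] by auto
  have EG: "mat_adjoint E * G i = 0\<^sub>m d d" if "i < n" for i
    unfolding G_def E_def using XLXL[OF _ _ F L[OF that], of 0 "Suc i"] that by simp
  define c where "c a j = cis (2 * pi * real a * real j / real n)" for a j
  have cc: "cnj (c a j) * c a j = 1" for a j by (simp add: c_def cis_cnj cis_mult)
  define W where "W a = rsum D2 d (\<lambda>j. c a j \<cdot>\<^sub>m G j) {..<n}" for a
  have W: "W a \<in> carrier_mat D2 d" for a by (simp add: W_def)
  have EW: "mat_adjoint E * W a = 0\<^sub>m d d" for a
  proof -
    have "mat_adjoint E * W a = rsum d d (\<lambda>j. mat_adjoint E * (c a j \<cdot>\<^sub>m G j)) {..<n}"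
      unfolding W_def using G by (intro mult_rsum[OF mat_adjoint_carrier[OF E]]) auto
    also have "\<dots> = 0\<^sub>m d d"
      by (rule rsum_zero) (auto simp: mult_smult_distrib[OF mat_adjoint_carrier[OF E] G] EG intro!: eq_matI)
    finally show ?thesis .
  qed
  have GW: "mat_adjoint (G i) * W a = c a i \<cdot>\<^sub>m (mat_adjoint (K i) * K i)" if i: "i < n" for a i
  proof -
    note G' = mat_adjoint_carrier[OF G[OF i]]
    have KK: "mat_adjoint (K i) * K i \<in> carrier_mat d d" by (rule mult_carrier_mat[OF mat_adjoint_carrier[OF K[OF i]] K[OF i]])
    have "mat_adjoint (G i) * W a = rsum d d (\<lambda>j. mat_adjoint (G i) * (c a j \<cdot>\<^sub>m G j)) {..<n}"
      unfolding W_def using G by (intro mult_rsum[OF G']) auto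
    also have "\<dots> = rsum d d (\<lambda>j. c a j \<cdot>\<^sub>m (if i = j then mat_adjoint (K i) * K i else 0\<^sub>m d d)) {..<n}"
      by (rule rsum_cong) (simp_all add: mult_smult_distrib[OF G' G] GG[OF i])
    also have "\<dots> = c a i \<cdot>\<^sub>m (if i = i then mat_adjoint (K i) * K i else 0\<^sub>m d d)"
      by (rule rsum_delta) (use i KK in \<open>auto intro!: eq_matI\<close>)
    finally show ?thesis by simp
  qed
  \<comment> \<open>Flags remove the cross terms and the phases have modulus 1, so what remains is
    the completeness relation of the Kraus operators.\<close>
  have WW: "mat_adjoint (W a) * W a = 1\<^sub>m d" for a
  proof -
    have "mat_adjoint (W a) = rsum d D2 (\<lambda>i. cnj (c a i) \<cdot>\<^sub>m mat_adjoint (G i)) {..<n}"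
      unfolding W_def using G by (subst mat_adjoint_rsum) (auto intro!: rsum_cong eq_matI)
    then have "mat_adjoint (W a) * W a = rsum d d (\<lambda>i. cnj (c a i) \<cdot>\<^sub>m mat_adjoint (G i) * W a) {..<n}"
      using G by (simp only:) (rule rsum_mult[OF W], auto)
    also have "\<dots> = rsum d d (\<lambda>i. mat_adjoint (K i) * K i) {..<n}"
    proof (rule rsum_cong)
      fix i assume "i \<in> {..<n}"
      then have i: "i < n" by simp
      have KK: "mat_adjoint (K i) * K i \<in> carrier_mat d d" by (rule mult_carrier_mat[OF mat_adjoint_carrier[OF K[OF i]] K[OF i]])
      have "cnj (c a i) \<cdot>\<^sub>m mat_adjoint (G i) * W a = cnj (c a i) \<cdot>\<^sub>m (c a i \<cdot>\<^sub>m (mat_adjoint (K i) * K i))"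
        using mult_smult_assoc_mat[OF mat_adjoint_carrier[OF G[OF i]] W] by (simp add: GW[OF i])
      also have "\<dots> = (cnj (c a i) * c a i) \<cdot>\<^sub>m (mat_adjoint (K i) * K i)"
        by (rule eq_matI) (auto simp: mult.assoc)
      also have "\<dots> = mat_adjoint (K i) * K i" unfolding cc by (rule eq_matI) auto
      finally show "cnj (c a i) \<cdot>\<^sub>m mat_adjoint (G i) * W a = mat_adjoint (K i) * K i" .
    qed simp
    finally show ?thesis by (simp add: complete)
  qed
  let ?D = "tdim (ds[k := D2])"
  have Ac: "A \<in> carrier_mat (tdim ds) (tdim ds)" using psd by simp
  have tds: "tdim (ds[k := d]) = tdim ds" by (simp add: d_def)
  \<comment> \<open>E adjoins two pure ancillas, first y and then flag 0, and neither changes the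
    value.\<close>
  have hE: "homog f (ds[k := D2]) (sand (loc ds k E) A) = homog f ds A"
  proof -
    have "sand (loc ds k E) A = sand (loc ds k (X 0)) (sand (loc ds k F) A)"
      unfolding E_def using Ac by (intro sand_loc_mult[OF kl X F]) (simp add: d_def)
    moreover have psdF: "psd (tdim (ds[k := D])) (sand (loc ds k F) A)"
      using loc_carrier[OF kl F] by (intro psd_sand[OF psd]) (simp add: d_def)
    have "homog f (ds[k := D2]) (sand (loc ds k (X 0)) (sand (loc ds k F) A))
        = homog f (ds[k := D]) (sand (loc ds k F) A)"
      using homog_flag[OF FLAGS _ k psdF xc, of 0] xx[of 0 0] len kl
      by (simp add: flag_iso_loc X_def D2_def del: mult_Suc_right)
    moreover have "homog f (ds[k := D]) (sand (loc ds k F) A) = homog f ds A"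
      using homog_flag[OF FLAGS len k psd y] by (simp add: flag_iso_loc F_def D_def d_def)
    ultimately show ?thesis by simp
  qed
  have hW: "homog f (ds[k := D2]) (sand (loc ds k (W a)) A) = homog f ds A" for a
    using homog_isometry[OF LUI len k psd, folded d_def, OF E W EE WW EW] hE by simp
  define H where "H j = loc ds k (G j)" for j
  have H: "H j \<in> carrier_mat ?D (tdim ds)" if "j < n" for j
    unfolding H_def using loc_carrier[OF kl G[OF that]] by (simp add: d_def)
  have locW: "loc ds k (W a) = rsum ?D (tdim ds) (\<lambda>j. c a j \<cdot>\<^sub>m H j) {..<n}" for a
    unfolding W_def H_def using G by (subst loc_rsum[OF kl]) (auto simp: loc_smult tds)
  have locWc: "loc ds k (W a) \<in> carrier_mat ?D (tdim ds)" for a by (simp add: locW)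
  have "rsum ?D ?D (\<lambda>a. complex_of_real (1 / real n) \<cdot>\<^sub>m sand (loc ds k (W a)) A) {..<n}
      = rsum ?D ?D (\<lambda>j. sand (H j) A) {..<n}"
    unfolding locW using H Ac n by (rule sand_phase_average) (auto simp: c_def sum_phases)
  moreover have "homog f (ds[k := D2]) (rsum ?D ?D (\<lambda>a. complex_of_real (1 / real n) \<cdot>\<^sub>m sand (loc ds k (W a)) A) {..<n})
      \<le> (\<Sum>a<n. homog f (ds[k := D2]) (complex_of_real (1 / real n) \<cdot>\<^sub>m sand (loc ds k (W a)) A))"
    using len by (intro homog_convex[OF conv] psd_smult psd_sand[OF psd locWc]) auto
  \<comment> \<open>All n terms of the average have the value of the input, so the upper bound from
    convexity collapses to that value.\<close>
  moreover have "\<dots> = homog f ds A"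
  proof -
    have "homog f (ds[k := D2]) (complex_of_real (1 / real n) \<cdot>\<^sub>m sand (loc ds k (W a)) A)
        = 1 / real n * homog f ds A" for a
      by (subst homog_smult[OF sand_carrier[OF locWc]]) (simp_all add: hW)
    then show ?thesis by (simp only:) (use n in simp)
  qed
  \<comment> \<open>[FLAGS] is used in the system of local dimension D; afterwards the embeddings
    \<open>V j\<close> are undone to return to the dimensions \<open>e j\<close>.\<close>
  moreover have "homog f (ds[k := D2]) (rsum ?D ?D (\<lambda>j. sand (H j) A) {..<n})
      = (\<Sum>j<n. homog f (ds[k := e j]) (sand (loc ds k (K j)) A))"
  proof -
    have psdL: "psd (tdim (ds[k := D])) (sand (loc ds k (L j)) A)" if "j < n" for j
      using loc_carrier[OF kl L[OF that]] by (intro psd_sand[OF psd]) (simp add: d_def)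
    have "rsum ?D ?D (\<lambda>j. sand (H j) A) {..<n}
      = rsum ?D ?D (\<lambda>j. sand (flag_iso (ds[k := D]) k (Suc n) (x (Suc j))) (sand (loc ds k (L j)) A)) {..<n}"
    proof (rule rsum_cong)
      fix j assume "j \<in> {..<n}"
      then have Lj: "L j \<in> carrier_mat D d" using L by simp
      then show "sand (H j) A = sand (flag_iso (ds[k := D]) k (Suc n) (x (Suc j))) (sand (loc ds k (L j)) A)"
        unfolding H_def G_def using Ac kl
        by (subst sand_loc_mult[OF kl X Lj]) (simp_all add: tds flag_iso_loc X_def)
    qed simp
    moreover have "homog f (ds[k := D2]) \<dots> = (\<Sum>j<n. homog f (ds[k := D]) (sand (loc ds k (L j)) A))"
      using homog_FLAGS[OF FLAGS _ k, of "ds[k := D]" n "\<lambda>j. sand (loc ds k (L j)) A" "\<lambda>j. x (Suc j)" "Suc n"]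
        psdL xc xx len kl
      by (simp add: D2_def del: mult_Suc_right)
    moreover have "homog f (ds[k := D]) (sand (loc ds k (L j)) A) = homog f (ds[k := e j]) (sand (loc ds k (K j)) A)"
      if j: "j < n" for j
    proof -
      have "sand (loc ds k (L j)) A = sand (loc ds k (V j)) (sand (loc ds k (K j)) A)"
        unfolding L_def using Ac by (intro sand_loc_mult[OF kl V[OF j] K[OF j]]) (simp add: d_def)
      moreover have "psd (tdim (ds[k := e j])) (sand (loc ds k (K j)) A)"
        using loc_carrier[OF kl K[OF j]] by (intro psd_sand[OF psd]) (simp add: d_def)
      ultimately show ?thesis using Vh[OF j] by simp
    qed
    ultimately show ?thesis by simp
  qed
  ultimately show ?thesis by simp
qed

section \<open>Sufficiency: induction over LOCC protocols\<close>

lemma out_unnorm_Nil [simp]: "out_unnorm (ds', []) \<rho> = 0\<^sub>m (tdim ds') (tdim ds')"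
  by (simp add: out_unnorm_def msum_rsum)

lemma out_unnorm_Cons:
  assumes "L \<in> carrier_mat (tdim ds') r"
  shows "out_unnorm (ds', L # Ls) \<rho> = sand L \<rho> + out_unnorm (ds', Ls) \<rho>"
  using rsum_lessThan_Suc_shift[of "\<lambda>i. sand ((L # Ls) ! i) \<rho>" "tdim ds'" "tdim ds'" "length Ls"]
    sand_carrier[OF assms]
  by (simp add: out_unnorm_def msum_rsum sand_def)

lemma out_unnorm_carrier [simp]:
  "out_unnorm (ds', Ls) \<rho> \<in> carrier_mat (tdim ds') (tdim ds')"
  by (simp add: out_unnorm_def msum_rsum)

lemma out_unnorm_append:
  assumes "\<forall>L\<in>set Ls. L \<in> carrier_mat (tdim ds') r" "\<forall>L\<in>set Ls'. L \<in> carrier_mat (tdim ds') r"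
  shows "out_unnorm (ds', Ls @ Ls') \<rho> = out_unnorm (ds', Ls) \<rho> + out_unnorm (ds', Ls') \<rho>"
  using assms(1)
proof (induction Ls)
  case Nil
  then show ?case by (simp add: left_add_zero_mat[OF out_unnorm_carrier])
next
  case (Cons L Ls)
  then have L: "L \<in> carrier_mat (tdim ds') r" by simp
  then show ?case using Cons
    by (simp add: out_unnorm_Cons[OF L] assoc_add_mat[OF sand_carrier[OF L] out_unnorm_carrier out_unnorm_carrier])
qed

lemma psd_out_unnorm:
  assumes "psd r \<rho>" "\<forall>L\<in>set Ls. L \<in> carrier_mat (tdim ds') r"
  shows "psd (tdim ds') (out_unnorm (ds', Ls) \<rho>)"
  using assms(2)
proof (induction Ls)
  case (Cons L Ls)
  then have L: "L \<in> carrier_mat (tdim ds') r" by simp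
  show ?case using Cons by (simp add: out_unnorm_Cons[OF L] psd_add psd_sand[OF assms(1) L])
qed simp

text \<open>The products that \<open>locc_round\<close> collects are the Kraus operators of the
  composed map, by linearity of conjugation. This lets an induction hypothesis be applied to the
  output of the first round.\<close>

lemma out_unnorm_compose:
  assumes M: "\<forall>M\<in>set Ms. M \<in> carrier_mat (tdim e) r" and L: "\<forall>L\<in>set Ls. L \<in> carrier_mat (tdim ds') (tdim e)"
    and \<rho>: "\<rho> \<in> carrier_mat r r"
  shows "out_unnorm (ds', [L * M. L \<leftarrow> Ls, M \<leftarrow> Ms]) \<rho> = out_unnorm (ds', Ls) (out_unnorm (e, Ms) \<rho>)"
  using L
proof (induction Ls)
  case (Cons L Ls)
  then have L: "L \<in> carrier_mat (tdim ds') (tdim e)" by simp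
  have "out_unnorm (ds', map (\<lambda>M. L * M) Ms) \<rho> = sand L (out_unnorm (e, Ms) \<rho>)"
    using M
  proof (induction Ms)
    case Nil
    then show ?case by (simp add: sand_zero[OF L])
  next
    case (Cons M Ms)
    then have M: "M \<in> carrier_mat (tdim e) r" by simp
    have "out_unnorm (ds', map (\<lambda>M. L * M) (M # Ms)) \<rho>
      = sand (L * M) \<rho> + out_unnorm (ds', map (\<lambda>M. L * M) Ms) \<rho>"
      using out_unnorm_Cons[OF mult_carrier_mat[OF L M]] by simp
    also have "\<dots> = sand L (sand M \<rho>) + sand L (out_unnorm (e, Ms) \<rho>)"
      using Cons by (simp add: sand_mult[OF L M \<rho>])
    also have "\<dots> = sand L (out_unnorm (e, M # Ms) \<rho>)"
      by (simp add: out_unnorm_Cons[OF M] sand_add[OF L sand_carrier[OF M] out_unnorm_carrier])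
    finally show ?case .
  qed
  moreover have "out_unnorm (ds', map (\<lambda>M. L * M) Ms @ [L * M. L \<leftarrow> Ls, M \<leftarrow> Ms]) \<rho>
    = out_unnorm (ds', map (\<lambda>M. L * M) Ms) \<rho> + out_unnorm (ds', [L * M. L \<leftarrow> Ls, M \<leftarrow> Ms]) \<rho>"
    using M L Cons.prems by (intro out_unnorm_append[where r = r]) auto
  ultimately show ?case using Cons
    by (simp add: out_unnorm_Cons[OF L])
qed simp

lemma homog_add:
  assumes "convex_fun N f" "length ds = N" "psd (tdim ds) A" "psd (tdim ds) B"
  shows "homog f ds (A + B) \<le> homog f ds A + homog f ds B"
proof -
  have "rsum (tdim ds) (tdim ds) (\<lambda>i. if i = 0 then A else B) {..<Suc (Suc 0)} = A + B"
    using psd_carrier[OF assms(3)] psd_carrier[OF assms(4)] by (intro eq_matI) auto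
  then show ?thesis
    using homog_convex[OF assms(1,2), of "Suc (Suc 0)" "\<lambda>i. if i = 0 then A else B"] assms(3,4) by simp
qed

text \<open>Subadditivity over the Kraus operators of one outcome: not learning which of them acted
  cannot increase the value.\<close>

lemma homog_out_unnorm_le:
  assumes conv: "convex_fun N f" and len: "length ds' = N" and psd: "psd r \<rho>"
    and L: "\<forall>L\<in>set Ls. L \<in> carrier_mat (tdim ds') r"
  shows "homog f ds' (out_unnorm (ds', Ls) \<rho>) \<le> (\<Sum>L\<leftarrow>Ls. homog f ds' (sand L \<rho>))"
  using L
proof (induction Ls)
  case (Cons L Ls)
  then have L: "L \<in> carrier_mat (tdim ds') r" by simp
  have "homog f ds' (sand L \<rho> + out_unnorm (ds', Ls) \<rho>)
      \<le> homog f ds' (sand L \<rho>) + homog f ds' (out_unnorm (ds', Ls) \<rho>)"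
    using Cons.prems by (intro homog_add[OF conv len] psd_sand[OF psd L] psd_out_unnorm[OF psd]) auto
  then show ?case using Cons by (simp add: out_unnorm_Cons[OF L])
qed simp

text \<open>The rules of \<open>locc\<close> record neither the formats of composed Kraus operators
  nor the number of parties; this invariant supplies both.\<close>

lemma locc_carrier:
  assumes "locc ds outs"
  shows "\<forall>(ds', Ls)\<in>set outs. length ds' = length ds \<and> (\<forall>L\<in>set Ls. L \<in> carrier_mat (tdim ds') (tdim ds))"
  using assms
proof (induction rule: locc.induct)
  case (locc_id ds)
  show ?case by simp
next
  case (locc_round k ds instr P)
  have K: "loc ds k K \<in> carrier_mat (tdim (ds[k := fst (instr ! j)])) (tdim ds)"
    if "j < length instr" "K \<in> set (snd (instr ! j))" for j K
    using locc_round.hyps(1,2) that by auto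
  have IH: "length ds' = length ds \<and> (\<forall>L\<in>set Ls. L \<in> carrier_mat (tdim ds') (tdim (ds[k := fst (instr ! j)])))"
    if "j < length instr" "(ds', Ls) \<in> set (P j)" for j ds' Ls
    using locc_round.IH that by fastforce
  have "L * loc ds k K \<in> carrier_mat (tdim ds') (tdim ds)"
    if "j < length instr" "(ds', Ls) \<in> set (P j)" "L \<in> set Ls" "K \<in> set (snd (instr ! j))" for j ds' Ls L K
    using IH[OF that(1,2)] that(3) K[OF that(1,4)] by (auto intro: mult_carrier_mat)
  then show ?case using IH by fastforce
next
  case (locc_merge ds outs i j)
  define a where "a = (fst (outs ! i), snd (outs ! i) @ snd (outs ! j))"
  have mem: "outs ! i \<in> set outs" "outs ! j \<in> set outs" using locc_merge.hyps by auto
  have "\<forall>(ds', Ls)\<in>insert a (set outs). length ds' = length ds \<and> (\<forall>L\<in>set Ls. L \<in> carrier_mat (tdim ds') (tdim ds))"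
    using locc_merge.IH mem locc_merge.hyps(5) by (auto simp: a_def case_prod_beta)
  \<comment> \<open>Merging introduces only the entry \<open>a\<close>; overwriting and deleting
    positions adds nothing else.\<close>
  moreover have "set (take j (outs[i := a]) @ drop (Suc j) (outs[i := a])) \<subseteq> insert a (set outs)"
    using set_update_subset_insert[of outs i a] set_take_subset[of j "outs[i := a]"]
      set_drop_subset[of "Suc j" "outs[i := a]"] by auto
  ultimately show ?case unfolding Let_def a_def[symmetric] by blast
qed

section \<open>Sums over lists of outcomes\<close>

lemma sum_list_concat_map_upt:
  fixes h :: "'a \<Rightarrow> real"
  shows "(\<Sum>x\<leftarrow>concat (map g [0..<n]). h x) = (\<Sum>j<n. \<Sum>x\<leftarrow>g j. h x)"
  by (induction n) auto

lemma sum_list_update_real: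
  fixes h :: "'a \<Rightarrow> real"
  assumes "i < length xs"
  shows "(\<Sum>x\<leftarrow>xs[i := a]. h x) = (\<Sum>x\<leftarrow>xs. h x) - h (xs ! i) + h a"
proof -
  have "(\<Sum>x\<leftarrow>xs. h x) = (\<Sum>x\<leftarrow>take i xs @ xs ! i # drop (Suc i) xs. h x)"
    using id_take_nth_drop[OF assms] by simp
  then show ?thesis by (simp add: upd_conv_take_nth_drop[OF assms])
qed

lemma sum_list_remove_nth_real:
  fixes h :: "'a \<Rightarrow> real"
  assumes "i < length xs"
  shows "(\<Sum>x\<leftarrow>take i xs @ drop (Suc i) xs. h x) = (\<Sum>x\<leftarrow>xs. h x) - h (xs ! i)"
proof -
  have "(\<Sum>x\<leftarrow>xs. h x) = (\<Sum>x\<leftarrow>take i xs @ xs ! i # drop (Suc i) xs. h x)"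
    using id_take_nth_drop[OF assms] by simp
  then show ?thesis by simp
qed

text \<open>The instrument is refined: each Kraus operator becomes an outcome of its own, paired
  with the output dimension of the outcome it came from. Completeness is a condition on the
  flattened list, so it survives the refinement.\<close>

lemma homog_instrument:
  assumes conv: "convex_fun N f" and LUI: "LUI N f" and FLAGS: "FLAGS N f"
    and len: "length ds = N" and k: "k < N"
    and K: "\<forall>j < length instr. \<forall>K \<in> set (snd (instr ! j)). K \<in> carrier_mat (fst (instr ! j)) (ds ! k)"
    and complete: "msum (ds ! k) (\<lambda>i. mat_adjoint (concat (map snd instr) ! i) * (concat (map snd instr) ! i))
            {..< length (concat (map snd instr))} = 1\<^sub>m (ds ! k)"
    and psd: "psd (tdim ds) \<rho>"
  shows "(\<Sum>j<length instr. \<Sum>K\<leftarrow>snd (instr ! j). homog f (ds[k := fst (instr ! j)]) (sand (loc ds k K) \<rho>))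
      \<le> homog f ds \<rho>"
proof -
  define eks where "eks = concat (map (\<lambda>(e, Ks). map (Pair e) Ks) instr)"
  define h where "h = (\<lambda>(e, K). homog f (ds[k := e]) (sand (loc ds k K) \<rho>))"
  have snds: "map snd eks = concat (map snd instr)"
    by (auto simp: eks_def map_concat comp_def case_prod_beta)
  have lens: "length (concat (map snd instr)) = length eks" by (simp flip: snds)
  have nths: "concat (map snd instr) ! i = snd (eks ! i)" if "i < length eks" for i
    using that by (simp flip: snds)
  have Kc: "snd x \<in> carrier_mat (fst x) (ds ! k)" if "x \<in> set eks" for x
    using that K by (fastforce simp: eks_def in_set_conv_nth[of _ instr])
  have "(\<Sum>i<length eks. homog f (ds[k := fst (eks ! i)]) (sand (loc ds k (snd (eks ! i))) \<rho>)) \<le> homog f ds \<rho>"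
  proof (rule homog_kraus[OF conv LUI FLAGS len k _ _ psd])
    have "rsum (ds ! k) (ds ! k) (\<lambda>i. mat_adjoint (snd (eks ! i)) * snd (eks ! i)) {..<length eks}
      = rsum (ds ! k) (ds ! k) (\<lambda>i. mat_adjoint (concat (map snd instr) ! i) * (concat (map snd instr) ! i))
            {..< length (concat (map snd instr))}"
      unfolding lens by (rule rsum_cong) (simp_all add: nths)
    then show "rsum (ds ! k) (ds ! k) (\<lambda>i. mat_adjoint (snd (eks ! i)) * snd (eks ! i)) {..<length eks} = 1\<^sub>m (ds ! k)"
      using complete unfolding msum_rsum by simp
  qed (use Kc in auto)
  also have "(\<Sum>i<length eks. homog f (ds[k := fst (eks ! i)]) (sand (loc ds k (snd (eks ! i))) \<rho>)) = (\<Sum>x\<leftarrow>eks. h x)"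
    by (simp add: sum_list_sum_nth h_def case_prod_beta atLeast0LessThan)
  also have "eks = concat (map (\<lambda>j. map (Pair (fst (instr ! j))) (snd (instr ! j))) [0..<length instr])"
  proof -
    have "map (\<lambda>j. map (Pair (fst (instr ! j))) (snd (instr ! j))) [0..<length instr]
      = map (\<lambda>(e, Ks). map (Pair e) Ks) (map (\<lambda>j. instr ! j) [0..<length instr])"
      by (simp add: case_prod_beta)
    then show ?thesis by (simp add: eks_def map_nth)
  qed
  finally show ?thesis by (simp add: sum_list_concat_map_upt h_def comp_def)
qed

text \<open>The extension to positive semidefinite matrices pays off here: the induction hypothesis
  is applied to the unnormalised state left by the first round. In a round, the continuation is
  bounded first, then each message is split into its Kraus operators, and then the instrument is
  bounded. Merging is subadditivity for two terms.\<close>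

lemma homog_locc:
  assumes conv: "convex_fun N f" and LUI: "LUI N f" and FLAGS: "FLAGS N f" and locc: "locc ds outs"
  shows "length ds = N \<Longrightarrow> psd (tdim ds) \<rho> \<Longrightarrow>
    (\<Sum>o'\<leftarrow>outs. homog f (fst o') (out_unnorm o' \<rho>)) \<le> homog f ds \<rho>"
  using locc
proof (induction arbitrary: \<rho> rule: locc.induct)
  case (locc_id ds)
  have \<rho>: "\<rho> \<in> carrier_mat (tdim ds) (tdim ds)" using locc_id.prems by simp
  have "out_unnorm (ds, [1\<^sub>m (tdim ds)]) \<rho> = \<rho>"
    using \<rho> by (simp add: out_unnorm_Cons[OF one_carrier_mat])
  then show ?case by simp
next
  case (locc_round k ds instr P)
  note len = locc_round.prems(1) and psd = locc_round.prems(2)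
  have \<rho>: "\<rho> \<in> carrier_mat (tdim ds) (tdim ds)" using psd by simp
  define h where "h o' = homog f (fst o') (out_unnorm o' \<rho>)" for o'
  define g where "g j = map (\<lambda>(ds'', Ls). (ds'', [L * loc ds k K. L \<leftarrow> Ls, K \<leftarrow> snd (instr ! j)])) (P j)" for j
  have g: "(\<Sum>o'\<leftarrow>g j. h o') \<le> (\<Sum>K\<leftarrow>snd (instr ! j). homog f (ds[k := fst (instr ! j)]) (sand (loc ds k K) \<rho>))"
    if j: "j < length instr" for j
  proof -
    define e where "e = ds[k := fst (instr ! j)]"
    define Ms where "Ms = map (loc ds k) (snd (instr ! j))"
    have M: "\<forall>M\<in>set Ms. M \<in> carrier_mat (tdim e) (tdim ds)"
      using locc_round.hyps(1,2) j by (auto simp: Ms_def e_def)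
    have lP: "locc e (P j)" using locc_round.IH j by (simp add: e_def)
    have comp: "out_unnorm (ds', [L * loc ds k K. L \<leftarrow> Ls, K \<leftarrow> snd (instr ! j)]) \<rho>
        = out_unnorm (ds', Ls) (out_unnorm (e, Ms) \<rho>)" if "(ds', Ls) \<in> set (P j)" for ds' Ls
      using out_unnorm_compose[OF M _ \<rho>, of Ls ds'] locc_carrier[OF lP] that
      by (fastforce simp: Ms_def comp_def)
    have "(\<Sum>o'\<leftarrow>g j. h o') = (\<Sum>o'\<leftarrow>P j. homog f (fst o') (out_unnorm o' (out_unnorm (e, Ms) \<rho>)))"
      unfolding g_def map_map by (intro arg_cong[where f = sum_list] map_cong) (auto simp: h_def comp)
    also have "\<dots> \<le> homog f e (out_unnorm (e, Ms) \<rho>)"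
    proof -
      have "length e = N" using len by (simp add: e_def)
      moreover have "psd (tdim e) (out_unnorm (e, Ms) \<rho>)" by (rule psd_out_unnorm[OF psd M])
      ultimately show ?thesis using locc_round.IH j unfolding e_def by blast
    qed
    also have "\<dots> \<le> (\<Sum>M\<leftarrow>Ms. homog f e (sand M \<rho>))"
      using len by (intro homog_out_unnorm_le[OF conv _ psd M]) (simp add: e_def)
    finally show ?thesis by (simp add: Ms_def e_def comp_def)
  qed
  have "(\<Sum>o'\<leftarrow>concat (map g [0..<length instr]). h o') = (\<Sum>j<length instr. \<Sum>o'\<leftarrow>g j. h o')"
    by (rule sum_list_concat_map_upt)
  also have "\<dots> \<le> (\<Sum>j<length instr. \<Sum>K\<leftarrow>snd (instr ! j). homog f (ds[k := fst (instr ! j)]) (sand (loc ds k K) \<rho>))"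
    using g by (intro sum_mono) auto
  also have "\<dots> \<le> homog f ds \<rho>"
    using locc_round.hyps(1-3) len by (intro homog_instrument[OF conv LUI FLAGS len _ _ _ psd]) auto
  finally show ?case unfolding g_def h_def .
next
  case (locc_merge ds outs i j)
  define h where "h o' = homog f (fst o') (out_unnorm o' \<rho>)" for o'
  define a where "a = (fst (outs ! i), snd (outs ! i) @ snd (outs ! j))"
  let ?ds' = "fst (outs ! i)"
  have car: "length ?ds' = length ds" "\<forall>L\<in>set (snd (outs ! i)). L \<in> carrier_mat (tdim ?ds') (tdim ds)"
     "\<forall>L\<in>set (snd (outs ! j)). L \<in> carrier_mat (tdim ?ds') (tdim ds)"
    using locc_carrier[OF locc_merge.hyps(1)] nth_mem[OF locc_merge.hyps(2)] nth_mem[OF locc_merge.hyps(3)]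
      locc_merge.hyps(5) by (auto simp: case_prod_beta)
  have "out_unnorm a \<rho> = out_unnorm (?ds', snd (outs ! i)) \<rho> + out_unnorm (?ds', snd (outs ! j)) \<rho>"
    unfolding a_def using car by (intro out_unnorm_append) auto
  also have "homog f ?ds' \<dots> \<le> homog f ?ds' (out_unnorm (?ds', snd (outs ! i)) \<rho>)
      + homog f ?ds' (out_unnorm (?ds', snd (outs ! j)) \<rho>)"
    using car locc_merge.prems by (intro homog_add[OF conv] psd_out_unnorm) auto
  also have "(?ds', snd (outs ! i)) = outs ! i" by simp
  also have "(?ds', snd (outs ! j)) = outs ! j" using locc_merge.hyps(5) by simp
  finally have "h a \<le> h (outs ! i) + h (outs ! j)"
    using locc_merge.hyps(5) unfolding h_def by (simp add: a_def)
  moreover have "(\<Sum>o'\<leftarrow>take j (outs[i := a]) @ drop (Suc j) (outs[i := a]). h o')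
      = (\<Sum>o'\<leftarrow>outs. h o') - h (outs ! i) + h a - h (outs ! j)"
    using locc_merge.hyps(2-4)
    by (subst sum_list_remove_nth_real) (simp_all add: sum_list_update_real)
  ultimately show ?case using locc_merge.IH[OF locc_merge.prems]
    unfolding Let_def a_def[symmetric] h_def by linarith
qed

lemma locc_monotone_if_LUI_FLAGS:
  assumes "convex_fun N f" "LUI N f" "FLAGS N f"
  shows "locc_monotone N f"
  unfolding locc_monotone_def
proof (intro allI impI)
  fix ds outs \<rho> assume "length ds = N" "locc ds outs" "mstate ds \<rho>"
  then show "(\<Sum>o'\<leftarrow>outs. out_prob o' \<rho> * f (fst o') (out_state o' \<rho>)) \<le> f ds \<rho>"
    using homog_locc[OF assms, of ds outs \<rho>]
    by (simp add: mstate_def density_def homog_trace_one homog_def[of _ "fst _"] out_prob_def out_state_def)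
qed

section \<open>Necessity\<close>

text \<open>One round whose continuations all do nothing; the identity operators of these
  continuations are absorbed in the products.\<close>

lemma locc_instrument:
  assumes k: "k < length ds"
    and K: "\<And>e Ks K. (e, Ks) \<in> set instr \<Longrightarrow> K \<in> set Ks \<Longrightarrow> K \<in> carrier_mat e (ds ! k)"
    and complete: "msum (ds ! k) (\<lambda>i. mat_adjoint (concat (map snd instr) ! i) * (concat (map snd instr) ! i))
            {..< length (concat (map snd instr))} = 1\<^sub>m (ds ! k)"
  shows "locc ds (map (\<lambda>(e, Ks). (ds[k := e], map (loc ds k) Ks)) instr)"
proof -
  define P where "P j = [(ds[k := fst (instr ! j)], [1\<^sub>m (tdim (ds[k := fst (instr ! j)])) :: complex mat])]" for j
  have K': "\<forall>j<length instr. \<forall>K\<in>set (snd (instr ! j)). K \<in> carrier_mat (fst (instr ! j)) (ds ! k)"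
    using K by (metis nth_mem prod.collapse)
  have "locc ds (concat (map (\<lambda>j. map (\<lambda>(ds'', Ls). (ds'',
              [L * loc ds k K. L \<leftarrow> Ls, K \<leftarrow> snd (instr ! j)])) (P j)) [0..< length instr]))"
    by (rule locc_round[OF k K' complete]) (simp add: P_def locc_id)
  also have "map (\<lambda>j. map (\<lambda>(ds'', Ls). (ds'', [L * loc ds k K. L \<leftarrow> Ls, K \<leftarrow> snd (instr ! j)])) (P j)) [0..< length instr]
     = map (\<lambda>j. [(ds[k := fst (instr ! j)], map (loc ds k) (snd (instr ! j)))]) [0..< length instr]"
    using K' k by (auto simp: P_def left_mult_one_mat[OF loc_carrier'])
  also have "concat \<dots> = map (\<lambda>j. (\<lambda>(e, Ks). (ds[k := e], map (loc ds k) Ks)) (instr ! j)) [0..< length instr]"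
    by (simp add: concat_map_singleton case_prod_beta)
  also have "\<dots> = map (\<lambda>(e, Ks). (ds[k := e], map (loc ds k) Ks)) (map (\<lambda>j. instr ! j) [0..< length instr])"
    unfolding map_map comp_def ..
  finally show ?thesis by (simp only: map_nth)
qed

text \<open>Monotonicity for a measurement by one party with one Kraus operator per outcome. Writing
  it with \<open>homog\<close> avoids dividing by probabilities that may be zero.\<close>

lemma locc_monotone_measurement:
  assumes mono: "locc_monotone N f" and len: "length ds = N" and k: "k < N"
    and K: "\<And>e K. (e, K) \<in> set eks \<Longrightarrow> K \<in> carrier_mat e (ds ! k)"
    and complete: "rsum (ds ! k) (ds ! k) (\<lambda>i. mat_adjoint (snd (eks ! i)) * snd (eks ! i)) {..<length eks} = 1\<^sub>m (ds ! k)"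
    and \<rho>: "mstate ds \<rho>"
  shows "(\<Sum>(e, K)\<leftarrow>eks. homog f (ds[k := e]) (sand (loc ds k K) \<rho>)) \<le> f ds \<rho>"
proof -
  have kl: "k < length ds" using k len by simp
  define instr where "instr = map (\<lambda>(e, K). (e, [K])) eks"
  have snds: "concat (map snd instr) = map snd eks"
    by (simp add: instr_def comp_def case_prod_beta concat_map_singleton)
  define outs where "outs = map (\<lambda>(e, Ks). (ds[k := e], map (loc ds k) Ks)) instr"
  have "locc ds outs" unfolding outs_def
  proof (rule locc_instrument[OF kl])
    show "msum (ds ! k) (\<lambda>i. mat_adjoint (concat (map snd instr) ! i) * (concat (map snd instr) ! i))
            {..< length (concat (map snd instr))} = 1\<^sub>m (ds ! k)"
      unfolding snds msum_rsum complete[symmetric] by (rule rsum_cong) simp_all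
  qed (use K in \<open>auto simp: instr_def\<close>)
  then have "(\<Sum>o'\<leftarrow>outs. homog f (fst o') (out_unnorm o' \<rho>)) \<le> f ds \<rho>"
    using mono len \<rho> unfolding locc_monotone_def
    by (simp add: homog_def out_prob_def out_state_def)
  also have "(\<Sum>o'\<leftarrow>outs. homog f (fst o') (out_unnorm o' \<rho>))
    = (\<Sum>(e, K)\<leftarrow>eks. homog f (ds[k := e]) (sand (loc ds k K) \<rho>))"
  proof -
    have "out_unnorm (ds[k := e], [loc ds k K]) \<rho> = sand (loc ds k K) \<rho>" if "(e, K) \<in> set eks" for e K
    proof -
      note c = loc_carrier'[OF kl K[OF that]]
      show ?thesis by (simp add: out_unnorm_Cons[OF c] right_add_zero_mat[OF sand_carrier[OF c]])
    qed
    then show ?thesis unfolding outs_def instr_def map_map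
      by (intro arg_cong[where f = sum_list] map_cong) auto
  qed
  finally show ?thesis .
qed

lemma density_sand_isometry:
  assumes "density c \<rho>" "V \<in> carrier_mat r c" "mat_adjoint V * V = 1\<^sub>m c"
  shows "density r (sand V \<rho>)"
  using assms psd_sand[of c \<rho> V r] mtrace_sand_isometry[of V r c \<rho>] by (simp add: density_def)

text \<open>An isometry is a complete instrument with a single Kraus operator, and its outcome
  occurs with probability 1.\<close>

lemma locc_monotone_isometry:
  assumes mono: "locc_monotone N f" and len: "length ds = N" and k: "k < N"
    and V: "V \<in> carrier_mat e (ds ! k)" and VV: "mat_adjoint V * V = 1\<^sub>m (ds ! k)"
    and \<rho>: "mstate ds \<rho>"
  shows "f (ds[k := e]) (sand (loc ds k V) \<rho>) \<le> f ds \<rho>"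
proof -
  have kl: "k < length ds" using k len by simp
  have V'V: "mat_adjoint V * V \<in> carrier_mat (ds ! k) (ds ! k)" by (simp add: VV)
  have "(\<Sum>(e, K)\<leftarrow>[(e, V)]. homog f (ds[k := e]) (sand (loc ds k K) \<rho>)) \<le> f ds \<rho>"
    by (rule locc_monotone_measurement[OF mono len k _ _ \<rho>])
      (use V V'V in \<open>auto simp: VV rsum_lessThan_Suc left_add_zero_mat\<close>)
  moreover have "density (tdim (ds[k := e])) (sand (loc ds k V) \<rho>)"
    using loc_isometry[OF kl V VV] \<rho> by (intro density_sand_isometry[OF _ loc_carrier'[OF kl V]]) (simp_all add: mstate_def)
  ultimately show ?thesis by (simp add: homog_trace_one density_def)
qed

lemma LUI_if_locc_monotone:
  assumes mono: "locc_monotone N f"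
  shows "LUI N f"
  unfolding LUI_def
proof (intro allI impI)
  fix ds \<rho> Us
  assume len: "length ds = N" and \<rho>: "mstate ds \<rho>" and lenU: "length Us = N"
    and "\<forall>k<N. unitary_mat (ds ! k) (Us ! k)"
  then have U: "unitary_mat (ds ! k) (Us ! k)" if "k < N" for k using that by blast
  have Uc: "Us ! k \<in> carrier_mat (ds ! k) (ds ! k)" if "k < N" for k
    using U[OF that] by (simp add: unitary_mat_def)
  have loc_inv: "f ds (sand (loc ds k (Us ! k)) \<sigma>) = f ds \<sigma>" "mstate ds (sand (loc ds k (Us ! k)) \<sigma>)"
    if k: "k < N" and \<sigma>: "mstate ds \<sigma>" for k \<sigma>
  proof -
    have kl: "k < length ds" using k len by simp
    define V where "V = Us ! k"
    have V: "V \<in> carrier_mat (ds ! k) (ds ! k)" "mat_adjoint V * V = 1\<^sub>m (ds ! k)" "V * mat_adjoint V = 1\<^sub>m (ds ! k)"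
      using U[OF k] by (auto simp: V_def unitary_mat_def)
    have \<sigma>c: "\<sigma> \<in> carrier_mat (tdim ds) (tdim ds)" using \<sigma> by (simp add: mstate_def density_def)
    show st: "mstate ds (sand (loc ds k (Us ! k)) \<sigma>)"
      using loc_isometry[OF kl V(1,2)] loc_carrier'[OF kl V(1)] \<sigma>
      unfolding mstate_def V_def[symmetric] by (intro density_sand_isometry) auto
    have "f ds (sand (loc ds k V) \<sigma>) \<le> f ds \<sigma>"
      using locc_monotone_isometry[OF mono len k V(1,2) \<sigma>] by simp
    moreover have "f ds (sand (loc ds k (mat_adjoint V)) (sand (loc ds k V) \<sigma>)) \<le> f ds (sand (loc ds k V) \<sigma>)"
      using locc_monotone_isometry[OF mono len k mat_adjoint_carrier[OF V(1)] _ st] V by (simp add: V_def)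
    moreover have "sand (loc ds k (mat_adjoint V)) (sand (loc ds k V) \<sigma>) = \<sigma>"
      using sand_loc_mult[OF kl mat_adjoint_carrier[OF V(1)] V(1), of \<sigma>] \<sigma>c kl by (simp add: V(2))
    ultimately show "f ds (sand (loc ds k (Us ! k)) \<sigma>) = f ds \<sigma>" by (simp add: V_def)
  qed
  \<comment> \<open>\<open>T j\<close> applies the given unitaries to the first j parties and the
    identity to the others. It leads from the identity at j = 0 to \<open>kron_list Us\<close> at j
    = N, one local unitary at a time.\<close>
  define T where "T j = take j Us @ map 1\<^sub>m (drop j ds)" for j
  have "f ds (sand (kron_list (T j)) \<rho>) = f ds \<rho> \<and> mstate ds (sand (kron_list (T j)) \<rho>)
      \<and> kron_list (T j) \<in> carrier_mat (tdim ds) (tdim ds)" if "j \<le> N" for j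
    using that
  proof (induction j)
    case 0
    have "\<rho> \<in> carrier_mat (tdim ds) (tdim ds)" using \<rho> by (simp add: mstate_def density_def)
    then show ?case using \<rho> by (simp add: T_def)
  next
    case (Suc j)
    then have j: "j < N" by simp
    then have jl: "j < length ds" using len by simp
    let ?A = "kron_list (take j Us)" and ?Q = "prod_list (drop (Suc j) ds)" and ?P = "prod_list (take j ds)"
    have A: "?A \<in> carrier_mat ?P ?P"
      using j len lenU Uc by (intro kron_list_carrier) auto
    have Tj: "kron_list (T j) = kron ?A (kron (1\<^sub>m (ds ! j)) (1\<^sub>m ?Q))"
      unfolding T_def Cons_nth_drop_Suc[OF jl, symmetric] by (simp only: kron_list_append list.map kron_list.simps kron_list_ones)
    have "kron_list (T (Suc j)) = kron ?A (kron (Us ! j) (1\<^sub>m ?Q))"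
      unfolding T_def using j lenU by (simp add: take_Suc_conv_app_nth kron_list_append kron_assoc)
    also have "\<dots> = loc ds j (Us ! j) * kron_list (T j)"
    proof -
      have "kron (Us ! j) (1\<^sub>m ?Q) * kron (1\<^sub>m (ds ! j)) (1\<^sub>m ?Q) = kron (Us ! j) (1\<^sub>m ?Q)"
        by (subst kron_mult[OF Uc[OF j] one_carrier_mat one_carrier_mat one_carrier_mat]) (simp add: right_mult_one_mat[OF Uc[OF j]])
      then show ?thesis unfolding Tj loc_def
        by (subst kron_mult[OF one_carrier_mat kron_carrier[OF Uc[OF j] one_carrier_mat] A
            kron_carrier[OF one_carrier_mat one_carrier_mat]]) (simp only: left_mult_one_mat[OF A])
    qed
    finally have T: "kron_list (T (Suc j)) = loc ds j (Us ! j) * kron_list (T j)" .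
    have Lc: "loc ds j (Us ! j) \<in> carrier_mat (tdim ds) (tdim ds)" using loc_carrier'[OF jl Uc[OF j]] by simp
    have IH: "f ds (sand (kron_list (T j)) \<rho>) = f ds \<rho>" "mstate ds (sand (kron_list (T j)) \<rho>)"
      "kron_list (T j) \<in> carrier_mat (tdim ds) (tdim ds)" using Suc by auto
    have "\<rho> \<in> carrier_mat (tdim ds) (tdim ds)" using \<rho> by (simp add: mstate_def density_def)
    then have s: "sand (kron_list (T (Suc j))) \<rho> = sand (loc ds j (Us ! j)) (sand (kron_list (T j)) \<rho>)"
      unfolding T by (rule sand_mult[OF Lc IH(3)])
    have "kron_list (T (Suc j)) \<in> carrier_mat (tdim ds) (tdim ds)"
      unfolding T by (rule mult_carrier_mat[OF Lc IH(3)])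
    then show ?case using loc_inv[OF j IH(2)] IH(1) by (simp add: s)
  qed
  from this[of N] show "f ds (kron_list Us * \<rho> * mat_adjoint (kron_list Us)) = f ds \<rho>"
    using len lenU by (simp add: T_def sand_def)
qed

lemma FLAGS_if_locc_monotone:
  assumes mono: "locc_monotone N f" and conv: "convex_fun N f"
  shows "FLAGS N f"
  unfolding FLAGS_def msum_rsum
proof (intro allI impI)
  fix ds k m and n :: nat and p :: "nat \<Rightarrow> real" and \<rho> and x :: "nat \<Rightarrow> complex vec"
  assume len: "length ds = N" and k: "k < N"
    and hyp: "\<forall>i<n. mstate ds (\<rho> i) \<and> 0 \<le> p i \<and> x i \<in> carrier_vec m"
    and sum1: "(\<Sum>i<n. p i) = 1"
    and orth: "\<forall>i<n. \<forall>j<n. conjugate (x i) \<bullet> x j = (if i = j then 1 else 0)"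
  have kl: "k < length ds" using k len by simp
  define d where "d = ds ! k"
  define D where "D = d * m"
  define ds' where "ds' = ds[k := D]"
  have ds'k: "ds' ! k = D" and len': "length ds' = N" and ds'd: "ds'[k := d] = ds"
    and loc': "loc ds' k = loc ds k" and tds: "tdim (ds[k := d]) = tdim ds"
    using kl len by (simp_all add: ds'_def d_def)
  have kl': "k < length ds'" using k len' by simp
  have st: "mstate ds (\<rho> i)" and p: "0 \<le> p i" and xc: "x i \<in> carrier_vec m" if "i < n" for i
    using hyp that by auto
  have \<rho>c: "\<rho> i \<in> carrier_mat (tdim ds) (tdim ds)" if "i < n" for i
    using st[OF that] by (simp add: mstate_def density_def)
  define F where "F i = flag_op d m (x i)" for i
  have F: "F i \<in> carrier_mat D d" for i by (simp add: F_def D_def)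
  note F' = mat_adjoint_carrier[OF F]
  have FF: "mat_adjoint (F i) * F j = (if i = j then 1\<^sub>m d else 0\<^sub>m d d)" if "i < n" "j < n" for i j
    unfolding F_def using xc that orth by (auto simp: flag_op_isometry flag_op_orthogonal)
  have L: "loc ds k (F i) \<in> carrier_mat (tdim ds') (tdim ds)" for i
    using loc_carrier[OF kl F] by (simp add: ds'_def d_def)
  define S where "S i = sand (loc ds k (F i)) (\<rho> i)" for i
  have S: "S i \<in> carrier_mat (tdim ds') (tdim ds')" for i unfolding S_def by (rule sand_carrier[OF L])
  have Sst: "mstate ds' (S i)" if "i < n" for i
    unfolding mstate_def S_def
    using st[OF that] loc_isometry[OF kl F, of i] FF[OF that that]
    by (intro density_sand_isometry[OF _ L]) (simp_all add: mstate_def tds)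
  define \<sigma> where "\<sigma> = rsum (tdim ds') (tdim ds') (\<lambda>i. complex_of_real (p i) \<cdot>\<^sub>m S i) {..<n}"
  have le: "f ds' \<sigma> \<le> (\<Sum>i<n. p i * f ds (\<rho> i))"
  proof -
    have "f ds' \<sigma> \<le> (\<Sum>i<n. p i * f ds' (S i))"
      unfolding \<sigma>_def msum_rsum[symmetric]
      using conv[unfolded convex_fun_def, rule_format, of ds' n S p] len' Sst p sum1 by blast
    also have "\<dots> \<le> (\<Sum>i<n. p i * f ds (\<rho> i))"
    proof (intro sum_mono mult_left_mono)
      fix i assume "i \<in> {..<n}"
      then have i: "i < n" by simp
      show "f ds' (S i) \<le> f ds (\<rho> i)"
        using locc_monotone_isometry[OF mono len k, of "F i" D "\<rho> i"] F FF[OF i i] st[OF i]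
        by (simp add: S_def ds'_def d_def)
      show "0 \<le> p i" by (rule p[OF i])
    qed
    finally show ?thesis .
  qed
  have \<sigma>st: "mstate ds' \<sigma>"
  proof -
    have "psd (tdim ds') \<sigma>"
      unfolding \<sigma>_def using Sst p by (intro psd_rsum psd_smult) (auto simp: mstate_def density_def)
    moreover have "mtrace \<sigma> = (\<Sum>i<n. mtrace (complex_of_real (p i) \<cdot>\<^sub>m S i))"
      unfolding \<sigma>_def by (intro mtrace_rsum) (simp add: S)
    then have "mtrace \<sigma> = 1"
      using Sst sum1 by (simp add: mtrace_smult[OF S] mstate_def density_def flip: of_real_sum)
    ultimately show ?thesis by (simp add: mstate_def density_def)
  qed
  have sandS: "sand (loc ds k B) (S i) = sand (loc ds k (B * F i)) (\<rho> i)"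
    if "B \<in> carrier_mat b D" "i < n" for B b i
    unfolding S_def using sand_loc_mult[OF kl that(1) F] \<rho>c[OF that(2)] by (simp add: tds)
  have sand\<sigma>: "sand (loc ds k B) \<sigma> = rsum (tdim (ds[k := b])) (tdim (ds[k := b]))
      (\<lambda>i. complex_of_real (p i) \<cdot>\<^sub>m sand (loc ds k (B * F i)) (\<rho> i)) {..<n}"
    if B: "B \<in> carrier_mat b D" for B b
  proof -
    have Lb: "loc ds k B \<in> carrier_mat (tdim (ds[k := b])) (tdim ds')"
      using loc_carrier[OF kl B] by (simp add: ds'_def)
    have "sand (loc ds k B) \<sigma> = rsum (tdim (ds[k := b])) (tdim (ds[k := b]))
        (\<lambda>i. sand (loc ds k B) (complex_of_real (p i) \<cdot>\<^sub>m S i)) {..<n}"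
      unfolding \<sigma>_def by (rule sand_rsum[OF Lb]) (simp add: S)
    also have "\<dots> = rsum (tdim (ds[k := b])) (tdim (ds[k := b]))
      (\<lambda>i. complex_of_real (p i) \<cdot>\<^sub>m sand (loc ds k (B * F i)) (\<rho> i)) {..<n}"
      by (rule rsum_cong) (simp_all add: sand_smult[OF Lb S] sandS[OF B])
    finally show ?thesis .
  qed
  \<comment> \<open>R is the projection onto the subspace carrying the flags. They need not span the
    ancilla, so the operators \<open>mat_adjoint (F i)\<close> alone may fail to be complete; the
    complementary projection Z repairs this.\<close>
  define R where "R = rsum D D (\<lambda>i. F i * mat_adjoint (F i)) {..<n}"
  have R: "R \<in> carrier_mat D D" by (simp add: R_def)
  have FFc: "F i * mat_adjoint (F i) \<in> carrier_mat D D" for i by (rule mult_carrier_mat[OF F F'])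
  have RF: "R * F l = F l" if l: "l < n" for l
  proof -
    have "R * F l = rsum D d (\<lambda>i. F i * mat_adjoint (F i) * F l) {..<n}"
      unfolding R_def by (rule rsum_mult[OF F FFc])
    also have "\<dots> = rsum D d (\<lambda>i. if i = l then F l else 0\<^sub>m D d) {..<n}"
    proof (rule rsum_cong)
      fix i assume "i \<in> {..<n}"
      then show "F i * mat_adjoint (F i) * F l = (if i = l then F l else 0\<^sub>m D d)"
        unfolding assoc_mult_mat[OF F F' F] using FF[of i l] l
        by (auto simp: right_mult_one_mat[OF F] right_mult_zero_mat[OF F])
    qed simp
    also have "\<dots> = (if l = l then F l else 0\<^sub>m D d)"
      by (rule rsum_delta) (use l F in auto)
    finally show ?thesis by simp
  qed
  have RR: "R * R = R"
  proof -
    have "R * R = rsum D D (\<lambda>i. R * (F i * mat_adjoint (F i))) {..<n}"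
      by (subst (2) R_def) (rule mult_rsum[OF R FFc])
    also have "\<dots> = R"
      unfolding R_def[symmetric] assoc_mult_mat[OF R F F', symmetric]
      by (subst (2) R_def) (rule rsum_cong, simp_all add: RF)
    finally show ?thesis .
  qed
  have R': "mat_adjoint R = R"
    unfolding R_def by (subst mat_adjoint_rsum[OF FFc]) (simp add: mat_adjoint_mult[OF F F'])
  define Z where "Z = 1\<^sub>m D - R"
  have Z: "Z \<in> carrier_mat D D" unfolding Z_def by (rule minus_carrier_mat[OF R])
  have Z': "mat_adjoint Z = Z"
    unfolding Z_def mat_adjoint_minus[OF one_carrier_mat R] by (simp add: R')
  have ZF: "Z * F l = 0\<^sub>m D d" if "l < n" for l
    unfolding Z_def minus_mult_distrib_mat[OF one_carrier_mat R F] RF[OF that] left_mult_one_mat[OF F]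
    by (intro eq_matI) (auto simp: carrier_matD[OF F])
  have RZ: "R + Z * Z = 1\<^sub>m D"
  proof -
    have "Z * Z = Z"
      by (subst (1) Z_def, subst minus_mult_distrib_mat[OF one_carrier_mat R Z],
          subst (2) Z_def, subst mult_minus_distrib_mat[OF R one_carrier_mat R])
        (use R Z in \<open>auto simp: RR left_mult_one_mat[OF Z] right_mult_one_mat[OF R] intro!: eq_matI\<close>)
    then show ?thesis using R by (auto simp: Z_def intro!: eq_matI)
  qed
  \<comment> \<open>Outcome i reads flag i and discards the ancilla, returning to dimension d; the
    additional last outcome stays in dimension D.\<close>
  define eks where "eks = map (\<lambda>i. (d, mat_adjoint (F i))) [0..<n] @ [(D, Z)]"
  have "(\<Sum>(e, K)\<leftarrow>eks. homog f (ds'[k := e]) (sand (loc ds' k K) \<sigma>)) \<le> f ds' \<sigma>"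
  proof (rule locc_monotone_measurement[OF mono len' k _ _ \<sigma>st])
    show "K \<in> carrier_mat e (ds' ! k)" if "(e, K) \<in> set eks" for e K
      using that F' Z by (auto simp: eks_def ds'k)
    have "rsum D D (\<lambda>i. mat_adjoint (snd (eks ! i)) * snd (eks ! i)) {..<Suc n}
      = rsum D D (\<lambda>i. mat_adjoint (snd (eks ! i)) * snd (eks ! i)) {..<n} + Z * Z"
      using mult_carrier_mat[OF Z Z] by (subst rsum_lessThan_Suc) (simp_all add: eks_def nth_append Z')
    also have "rsum D D (\<lambda>i. mat_adjoint (snd (eks ! i)) * snd (eks ! i)) {..<n} = R"
      unfolding R_def by (rule rsum_cong) (simp_all add: eks_def nth_append)
    finally show "rsum (ds' ! k) (ds' ! k) (\<lambda>i. mat_adjoint (snd (eks ! i)) * snd (eks ! i)) {..<length eks}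
        = 1\<^sub>m (ds' ! k)"
      by (simp add: RZ ds'k eks_def)
  qed
  \<comment> \<open>Orthogonality of the flags selects the i-th summand, so the unnormalised output
    is \<open>\<rho> i\<close> with weight \<open>p i\<close>; a vanishing weight needs no separate
    treatment.\<close>
  moreover have "homog f (ds'[k := d]) (sand (loc ds' k (mat_adjoint (F i))) \<sigma>) = p i * f ds (\<rho> i)" if i: "i < n" for i
  proof -
    have "sand (loc ds k (mat_adjoint (F i))) \<sigma> = rsum (tdim ds) (tdim ds)
        (\<lambda>l. complex_of_real (p l) \<cdot>\<^sub>m sand (loc ds k (mat_adjoint (F i) * F l)) (\<rho> l)) {..<n}"
      using sand\<sigma>[OF F'] by (simp add: tds)
    also have "\<dots> = rsum (tdim ds) (tdim ds)
        (\<lambda>l. if l = i then complex_of_real (p i) \<cdot>\<^sub>m \<rho> i else 0\<^sub>m (tdim ds) (tdim ds)) {..<n}"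
    proof (rule rsum_cong)
      fix l assume "l \<in> {..<n}"
      then have l: "l < n" by simp
      have "sand (0\<^sub>m (tdim ds) (tdim ds)) (\<rho> l) = 0\<^sub>m (tdim ds) (tdim ds)"
        unfolding sand_def using \<rho>c[OF l] by simp
      then show "complex_of_real (p l) \<cdot>\<^sub>m sand (loc ds k (mat_adjoint (F i) * F l)) (\<rho> l)
          = (if l = i then complex_of_real (p i) \<cdot>\<^sub>m \<rho> i else 0\<^sub>m (tdim ds) (tdim ds))"
        unfolding FF[OF i l] using kl \<rho>c[OF l] by (auto simp: tds intro!: eq_matI)
    qed simp
    also have "\<dots> = (if i = i then complex_of_real (p i) \<cdot>\<^sub>m \<rho> i else 0\<^sub>m (tdim ds) (tdim ds))"
      by (rule rsum_delta) (use i \<rho>c[OF i] in auto)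
    finally have "homog f ds (sand (loc ds k (mat_adjoint (F i))) \<sigma>) = p i * homog f ds (\<rho> i)"
      using homog_smult[OF \<rho>c[OF i] p[OF i]] by simp
    then show ?thesis
      using st[OF i] by (simp add: ds'd loc' homog_trace_one mstate_def density_def)
  qed
  moreover have "homog f (ds'[k := D]) (sand (loc ds' k Z) \<sigma>) = 0"
  proof -
    \<comment> \<open>The mixture is supported in the range of R on party k, which Z annihilates, so
      the additional outcome never occurs.\<close>
    have "sand (loc ds k (Z * F l)) (\<rho> l) = 0\<^sub>m (tdim ds') (tdim ds')" if "l < n" for l
    proof -
      have "loc ds k (Z * F l) = 0\<^sub>m (tdim ds') (tdim ds)"
        unfolding ZF[OF that] using loc_zero[OF kl, of D d] by (simp only: tds ds'_def)
      then show ?thesis unfolding sand_def using \<rho>c[OF that] by simp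
    qed
    then have "sand (loc ds k Z) \<sigma> = 0\<^sub>m (tdim ds') (tdim ds')"
      unfolding sand\<sigma>[OF Z] ds'_def[symmetric] by (intro rsum_zero) (auto intro!: eq_matI)
    then show ?thesis by (simp add: loc')
  qed
  ultimately have ge: "(\<Sum>i<n. p i * f ds (\<rho> i)) \<le> f ds' \<sigma>"
    by (simp add: eks_def comp_def interv_sum_list_conv_sum_set_nat atLeast0LessThan)
  show "f (ds[k := ds ! k * m])
         (rsum (tdim (ds[k := ds ! k * m])) (tdim (ds[k := ds ! k * m]))
            (\<lambda>i. complex_of_real (p i) \<cdot>\<^sub>m
                 (flag_iso ds k m (x i) * \<rho> i * mat_adjoint (flag_iso ds k m (x i)))) {..<n})
       = (\<Sum>i<n. p i * f ds (\<rho> i))"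
    using le ge by (simp add: \<sigma>_def S_def F_def ds'_def D_def d_def flag_iso_loc sand_def)
qed

theorem theorem3:
  fixes N :: nat and f :: "nat list \<Rightarrow> complex mat \<Rightarrow> real"
  assumes "N \<ge> 2"
    and "convex_fun N f"
  shows "locc_monotone N f \<longleftrightarrow> LUI N f \<and> FLAGS N f"
  using LUI_if_locc_monotone FLAGS_if_locc_monotone locc_monotone_if_LUI_FLAGS assms(2) by blast

end
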